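(* Let $Y,Z$ be disjoint standard Borel spaces, let $H \subseteq Y \times Z$ be a locally countable directed Borel graph, and let $\ell : H \to \mathbb{R}^+$ be a Borel function. There is a Borel maximal matching $M \subseteq H$ such that for each edge $(y,z) \in M$, $$\ell(y,z) \ge 1 \quad\text{or}\quad \ell(y,z) \ge \tfrac{1}{2} \sup_{z' \in H_y \setminus Z_M} \ell(y,z'),$$ where $H_y := \{z'\in Z : (y,z')\in H\}$ and $Z_M$ is the set of $M$-matched points in $Z$.
   Context: $\mathbb{R}^+=(0,\infty)$. That $H\subseteq Y\times Z$ is locally countable means that for each $y\in Y$ the set $\{z:(y,z)\in H\}$ is countable and for each $z\in Z$ the set $\{y:(y,z)\in H\}$ is countable. A matching is a set $M\subseteq H$ of edges no two of which share a vertex; it is maximal if it is not properly contained in another matching $M'\subseteq H$. A vertex is $M$-matched if it is incident to an edge of $M$. The supremum of the empty set is taken to be $0$. *)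

theory Defs
  imports "HOL-Analysis.Analysis"
begin

(* A measurable space is represented by a measure; only its space and its
   sigma-algebra matter, the values of the measure are ignored. *)
definition standard_borel :: "'a measure \<Rightarrow> bool" where
  "standard_borel Y \<longleftrightarrow>
     (\<exists>X. separable_space X \<and> completely_metrizable_space X \<and>
          topspace X = space Y \<and> sets Y = sigma_sets (topspace X) {U. openin X U})"

definition locally_countable :: "'a set \<Rightarrow> 'a set \<Rightarrow> ('a \<times> 'a) set \<Rightarrow> bool" where
  "locally_countable A B H \<longleftrightarrow>
     (\<forall>y\<in>A. countable {z \<in> B. (y, z) \<in> H}) \<and> (\<forall>z\<in>B. countable {y \<in> A. (y, z) \<in> H})"

definition vertices_of :: "'a \<times> 'a \<Rightarrow> 'a set" where
  "vertices_of e = {fst e, snd e}"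

definition matching :: "('a \<times> 'a) set \<Rightarrow> ('a \<times> 'a) set \<Rightarrow> bool" where
  "matching H M \<longleftrightarrow>
     M \<subseteq> H \<and> (\<forall>e\<in>M. \<forall>e'\<in>M. e \<noteq> e' \<longrightarrow> vertices_of e \<inter> vertices_of e' = {})"

(* Maximality is among all matchings, Borel or not. *)
definition maximal_matching :: "('a \<times> 'a) set \<Rightarrow> ('a \<times> 'a) set \<Rightarrow> bool" where
  "maximal_matching H M \<longleftrightarrow> matching H M \<and> \<not> (\<exists>M'. matching H M' \<and> M \<subset> M')"

definition matched_vertices :: "('a \<times> 'a) set \<Rightarrow> 'a set" where
  "matched_vertices M = {v. \<exists>e\<in>M. v \<in> vertices_of e}"

(* The supremum over unmatched neighbours may be infinite, hence ennreal;
   in ennreal the supremum of the empty set is 0. *)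
definition sup_unmatched ::
  "'a measure \<Rightarrow> ('a \<times> 'a) set \<Rightarrow> ('a \<times> 'a \<Rightarrow> real) \<Rightarrow> ('a \<times> 'a) set \<Rightarrow> 'a \<Rightarrow> ennreal" where
  "sup_unmatched Z H l M y =
     (SUP z' \<in> {z' \<in> space Z. (y, z') \<in> H} - (space Z \<inter> matched_vertices M). ennreal (l (y, z')))"

end

theory Submission
  imports Defs
begin

text \<open>Every locally countable Borel graph between standard Borel spaces is a countable union of
  Borel partial injections whose Borel subsets have Borel projections: this is the Lusin--Novikov
  theorem, applied in both directions. For such a graph a Borel maximal matching is built greedily,
  adding one partial injection after the other, each restricted to the vertices that are still free.

  The length condition is obtained by running this construction successively on
  \<open>L\<^sub>k = {e \<in> H. l e \<ge> 2\<^sup>-\<^sup>k}\<close>, \<open>k = 0, 1, \<dots>\<close>, always on the free vertices. If \<open>(y, z)\<close> is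
  added at stage \<open>k + 1\<close>, then \<open>y\<close> was free after stage \<open>k\<close>, so by maximality at stage \<open>k\<close> every
  neighbour \<open>z'\<close> of \<open>y\<close> that stays unmatched has \<open>l (y, z') < 2\<^sup>-\<^sup>k \<le> 2 l (y, z)\<close>.

  For the Lusin--Novikov theorem, let \<open>\<phi>\<close> map a closed set of sequences continuously onto \<open>R\<close>. A finite
  set \<open>W\<close> of words is killed by countably many Borel functions if, off their graphs, no single \<open>x\<close>
  has points of \<open>R\<close> over it coming from each of the cylinders of \<open>W\<close>. There are countably many \<open>W\<close>, so
  one countable family kills all those that can be killed. If it does not cover \<open>R\<close>, then every
  surviving \<open>W\<close> can be split in two everywhere over a common \<open>x\<close>; otherwise Lusin separation would
  kill it. Iterating the splitting embeds the Cantor space into one section of \<open>R\<close>.\<close>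

section \<open>Analytic sets\<close>

instance "fun" :: (type, t0_space) t0_space
proof
  fix x y :: "'a \<Rightarrow> 'b" assume "x \<noteq> y"
  then obtain i where "x i \<noteq> y i" by auto
  then obtain U where "open U" "\<not> (x i \<in> U \<longleftrightarrow> y i \<in> U)"
    using t0_space_class.t0_space[OF \<open>x i \<noteq> y i\<close>] by auto
  then show "\<exists>U. open U \<and> \<not> (x \<in> U \<longleftrightarrow> y \<in> U)"
    by (intro exI[of _ "(\<lambda>f. f i) -` U"]) (simp_all add: open_vimage)
qed

instance "fun" :: (type, t1_space) t1_space
proof
  fix x y :: "'a \<Rightarrow> 'b" assume "x \<noteq> y"
  then obtain i where "x i \<noteq> y i" by auto
  then obtain U where "open U" "x i \<in> U" "y i \<notin> U"
    using t1_space_class.t1_space[OF \<open>x i \<noteq> y i\<close>] by auto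
  then show "\<exists>U. open U \<and> x \<in> U \<and> y \<notin> U"
    by (intro exI[of _ "(\<lambda>f. f i) -` U"]) (simp_all add: open_vimage)
qed

text \<open>Disjoint neighbourhoods at one differing coordinate pull back along the continuous
  projection. The class hierarchy passes through the two weaker axioms, hence their separate
  instances.\<close>

instance "fun" :: (type, t2_space) t2_space
proof
  fix x y :: "'a \<Rightarrow> 'b" assume "x \<noteq> y"
  then obtain i where "x i \<noteq> y i" by auto
  then obtain U V where UV: "open U" "open V" "x i \<in> U" "y i \<in> V" "U \<inter> V = {}"
    by (meson hausdorff)
  have "open ((\<lambda>f::'a \<Rightarrow> 'b. f i) -` W)" if "open W" for W
    using that by (intro open_vimage) auto
  with UV show "\<exists>U V. open U \<and> open V \<and> x \<in> U \<and> y \<in> V \<and> U \<inter> V = {}"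
    by (intro exI[of _ "(\<lambda>f. f i) -` U"] exI[of _ "(\<lambda>f. f i) -` V"]) auto
qed

text \<open>Pairing of naturals lets one sequence carry countably many sequences; this is the
  homeomorphism of Baire space with its countable power.\<close>

definition row :: "nat \<Rightarrow> (nat \<Rightarrow> nat) \<Rightarrow> nat \<Rightarrow> nat" where
  "row n c = (\<lambda>k. c (prod_encode (n, k)))"

lemma continuous_on_row [continuous_intros]: "continuous_on S (row n)"
  unfolding row_def
  by (rule continuous_on_coordinatewise_then_product,
      rule continuous_on_subset[OF continuous_on_product_coordinates]) simp

lemma rows_surj: "\<exists>c. \<forall>n. row n c = a n"
  by (rule exI[of _ "\<lambda>m. a (fst (prod_decode m)) (snd (prod_decode m))"]) (simp add: row_def)

text \<open>Closed subsets of Baire space serve as domains, rather than the whole space: the empty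
  set is then included, and closed conditions on parameters can simply be added to the
  domain.\<close>

definition analytic_set :: "'x::topological_space set \<Rightarrow> bool" where
  "analytic_set A \<longleftrightarrow>
     (\<exists>(C :: (nat \<Rightarrow> nat) set) f. closed C \<and> continuous_on C f \<and> A = f ` C)"

lemma analytic_set_image:
  assumes "analytic_set A" "continuous_on A g"
  shows "analytic_set (g ` A)"
proof -
  obtain C :: "(nat \<Rightarrow> nat) set" and f where "closed C" "continuous_on C f" "A = f ` C"
    using assms by (auto simp: analytic_set_def)
  moreover from this have "continuous_on C (g \<circ> f)"
    using assms(2) by (simp only: continuous_on_compose)
  ultimately show ?thesis
    unfolding analytic_set_def by (intro exI[of _ C] exI[of _ "g \<circ> f"]) (simp add: image_comp)
qed

text \<open>A parameter records in row 0 which set is meant and in row 1 a parameter for that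
  set.\<close>

lemma analytic_set_UN:
  fixes A :: "nat \<Rightarrow> 'x::topological_space set"
  assumes "\<And>n. analytic_set (A n)"
  shows "analytic_set (\<Union>n. A n)"
proof -
  have "\<forall>n. \<exists>(C :: (nat \<Rightarrow> nat) set) f. closed C \<and> continuous_on C f \<and> A n = f ` C"
    using assms by (auto simp: analytic_set_def)
  then obtain C :: "nat \<Rightarrow> (nat \<Rightarrow> nat) set" and f where
    Cf: "\<And>n. closed (C n)" "\<And>n. continuous_on (C n) (f n)" "\<And>n. A n = f n ` C n"
    by metis
  define D where "D = (\<Union>n. {c. row 0 c 0 = n} \<inter> row 1 -` C n)"
  have cl: "closed (row 1 -` C n)" for n
    using Cf(1) continuous_on_row by (simp add: closed_vimage)
  have co: "continuous_on UNIV (\<lambda>c. row 0 c 0)"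
    by (rule continuous_on_product_then_coordinatewise[OF continuous_on_row])
  have op: "open {c. row 0 c 0 = n}" for n
    using open_vimage[OF _ co, of "{n}"] by (simp add: vimage_def open_discrete)
  have op': "open {c. row 0 c 0 \<noteq> n}" for n
    using open_vimage[OF _ co, of "-{n}"] by (simp add: vimage_def open_discrete)
  \<comment> \<open>Each \<open>c\<close> selects exactly one index, so it lies outside
    \<open>D\<close> precisely when row 1 misses the one selected domain. This turns closedness of
    an infinite union into openness of another.\<close>
  have "- D = (\<Union>n. {c. row 0 c 0 = n} \<inter> - (row 1 -` C n))"
    by (auto simp: D_def)
  then have "open (- D)"
    using op cl by (simp only:) (intro open_UN ballI open_Int open_Compl)
  then have "closed D" by (simp add: closed_def)
  moreover have "continuous_on D (\<lambda>c. f (row 0 c 0) (row 1 c))"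
    unfolding continuous_on_topological
  proof (intro ballI allI impI)
    fix c B assume c: "c \<in> D" "open B" "f (row 0 c 0) (row 1 c) \<in> B"
    define n where "n = row 0 c 0"
    have "continuous_on (row 1 -` C n) (f n \<circ> row 1)"
      by (intro continuous_on_compose continuous_on_row continuous_on_subset[OF Cf(2)[of n]]) auto
    moreover have "c \<in> row 1 -` C n" using c by (auto simp: D_def n_def)
    moreover have "(f n \<circ> row 1) c \<in> B" using c by (simp add: n_def)
    ultimately obtain A where A: "open A" "c \<in> A"
      "\<And>d. d \<in> row 1 -` C n \<Longrightarrow> d \<in> A \<Longrightarrow> (f n \<circ> row 1) d \<in> B"
      using \<open>open B\<close> unfolding continuous_on_topological by metis
    \<comment> \<open>The selected index is constant near \<open>c\<close>, so locally the map is
      the continuous \<open>f n \<circ> row 1\<close>.\<close>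
    show "\<exists>A. open A \<and> c \<in> A \<and> (\<forall>d\<in>D. d \<in> A \<longrightarrow> f (row 0 d 0) (row 1 d) \<in> B)"
      using A op[of n] by (intro exI[of _ "A \<inter> {c. row 0 c 0 = n}"]) (auto simp: n_def D_def)
  qed
  moreover have "(\<Union>n. A n) = (\<lambda>c. f (row 0 c 0) (row 1 c)) ` D"
  proof (intro equalityI subsetI)
    fix x assume "x \<in> (\<Union>n. A n)"
    then obtain n a where a: "a \<in> C n" "x = f n a" by (auto simp: Cf)
    obtain c where "\<forall>m. row m c = (if m = 0 then (\<lambda>_. n) else a)"
      using rows_surj[of "\<lambda>m. if m = 0 then (\<lambda>_. n) else a"] by auto
    then have "row 0 c 0 = n" "row 1 c = a" by auto
    then show "x \<in> (\<lambda>c. f (row 0 c 0) (row 1 c)) ` D"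
      using a by (intro image_eqI[of _ _ c]) (auto simp: D_def)
  qed (auto simp: D_def Cf)
  ultimately show ?thesis
    unfolding analytic_set_def by blast
qed

lemma closed_Collect_eq_on:
  fixes f g :: "'x::topological_space \<Rightarrow> 'y::t2_space"
  assumes "closed K" "continuous_on K f" "continuous_on K g"
  shows "closed {c \<in> K. f c = g c}"
proof -
  have "continuous_on K (\<lambda>c. (f c, g c))" using assms by (intro continuous_on_Pair)
  then have "closed ((\<lambda>c. (f c, g c)) -` {y. \<exists>x. y = (x, x)} \<inter> K)"
    using assms(1) closed_diagonal continuous_on_closed_vimage by blast
  also have "(\<lambda>c. (f c, g c)) -` {y. \<exists>x. y = (x, x)} \<inter> K = {c \<in> K. f c = g c}" by auto
  finally show ?thesis .
qed

text \<open>One parameter carries a parameter for every set, subject to all of them naming the same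
  point; in a Hausdorff space this condition is closed.\<close>

lemma analytic_set_INT:
  fixes A :: "nat \<Rightarrow> 'x::t2_space set"
  assumes "\<And>n. analytic_set (A n)"
  shows "analytic_set (\<Inter>n. A n)"
proof -
  have "\<forall>n. \<exists>(C :: (nat \<Rightarrow> nat) set) f. closed C \<and> continuous_on C f \<and> A n = f ` C"
    using assms by (auto simp: analytic_set_def)
  then obtain C :: "nat \<Rightarrow> (nat \<Rightarrow> nat) set" and f where
    Cf: "\<And>n. closed (C n)" "\<And>n. continuous_on (C n) (f n)" "\<And>n. A n = f n ` C n"
    by metis
  define K where "K = (\<Inter>n. row n -` C n)"
  have "closed (row n -` C n)" for n
    using Cf(1) continuous_on_row by (simp add: closed_vimage)
  then have "closed K" unfolding K_def by (intro closed_INT) auto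
  have co: "continuous_on K (f n \<circ> row n)" for n
    by (intro continuous_on_compose continuous_on_row continuous_on_subset[OF Cf(2)[of n]])
       (auto simp: K_def)
  define D where "D = (\<Inter>n. {c \<in> K. (f n \<circ> row n) c = (f 0 \<circ> row 0) c})"
  have "closed D"
    unfolding D_def using closed_Collect_eq_on[OF \<open>closed K\<close> co co] by (intro closed_INT) auto
  moreover have "continuous_on D (f 0 \<circ> row 0)"
    by (rule continuous_on_subset[OF co]) (auto simp: D_def)
  moreover have "(\<Inter>n. A n) = (f 0 \<circ> row 0) ` D"
  proof (intro equalityI subsetI)
    fix x assume "x \<in> (\<Inter>n. A n)"
    then have "\<forall>n. \<exists>a. a \<in> C n \<and> x = f n a" by (auto simp: Cf)
    then obtain a where a: "\<And>n. a n \<in> C n" "\<And>n. x = f n (a n)" by metis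
    obtain c where "\<forall>m. row m c = a m" using rows_surj by blast
    then show "x \<in> (f 0 \<circ> row 0) ` D"
      using a by (intro image_eqI[of _ _ c]) (auto simp: D_def K_def)
  next
    fix x assume "x \<in> (f 0 \<circ> row 0) ` D"
    then obtain c where c: "c \<in> D" "x = f 0 (row 0 c)" by auto
    have "x = f n (row n c) \<and> row n c \<in> C n" for n
      using c unfolding D_def K_def by simp metis
    then show "x \<in> (\<Inter>n. A n)" using Cf(3) by blast
  qed
  ultimately show ?thesis unfolding analytic_set_def by blast
qed

lemma analytic_set_closed: "closed (C :: (nat \<Rightarrow> nat) set) \<Longrightarrow> analytic_set C"
  unfolding analytic_set_def by (intro exI[of _ C] exI[of _ id]) auto

lemma analytic_set_empty [simp]: "analytic_set {}"
  unfolding analytic_set_def by (intro exI[of _ "{}"]) auto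

lemma analytic_set_Un:
  assumes "analytic_set A" "analytic_set B" shows "analytic_set (A \<union> B)"
proof -
  have "analytic_set (\<Union>n. case n of 0 \<Rightarrow> A | Suc _ \<Rightarrow> B)"
    by (rule analytic_set_UN) (auto split: nat.split intro: assms)
  also have "(\<Union>n. case n of 0 \<Rightarrow> A | Suc _ \<Rightarrow> B) = A \<union> B"
    by (rule set_eqI) (metis (no_types, lifting) UN_iff Un_iff UNIV_I nat.case not0_implies_Suc)
  finally show ?thesis .
qed

lemma analytic_set_Int:
  fixes A B :: "'x::t2_space set"
  assumes "analytic_set A" "analytic_set B" shows "analytic_set (A \<inter> B)"
proof -
  have "analytic_set (\<Inter>n. case n of 0 \<Rightarrow> A | Suc _ \<Rightarrow> B)"
    by (rule analytic_set_INT) (auto split: nat.split intro: assms)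
  also have "(\<Inter>n. case n of 0 \<Rightarrow> A | Suc _ \<Rightarrow> B) = A \<inter> B"
    by (rule set_eqI) (metis (no_types, lifting) INT_iff Int_iff UNIV_I nat.case not0_implies_Suc)
  finally show ?thesis .
qed

lemma analytic_set_INT_finite:
  fixes A :: "'i \<Rightarrow> 'x::t2_space set"
  assumes "finite I" "I \<noteq> {}" "\<And>i. i \<in> I \<Longrightarrow> analytic_set (A i)"
  shows "analytic_set (\<Inter>i\<in>I. A i)"
  using assms by (induction rule: finite_ne_induct) (auto intro: analytic_set_Int)

text \<open>A fibre product: row 0 parametrizes a point \<open>x\<close>, row 1 a point of
  \<open>A\<close>, and the pairs for which that point is \<open>g x\<close> are kept.\<close>

lemma analytic_set_vimage:
  fixes g :: "'x::t2_space \<Rightarrow> 'y::t2_space"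
  assumes "analytic_set (UNIV :: 'x set)" "continuous_on UNIV g" "analytic_set A"
  shows "analytic_set (g -` A)"
proof -
  obtain C :: "(nat \<Rightarrow> nat) set" and f :: "_ \<Rightarrow> 'x" where
    C: "closed C" "continuous_on C f" "UNIV = f ` C"
    using assms by (auto simp: analytic_set_def)
  obtain D :: "(nat \<Rightarrow> nat) set" and h where D: "closed D" "continuous_on D h" "A = h ` D"
    using assms by (auto simp: analytic_set_def)
  define K where "K = row 0 -` C \<inter> row 1 -` D"
  have K: "closed K"
    unfolding K_def using C D continuous_on_row by (intro closed_Int) (simp_all add: closed_vimage)
  have cf: "continuous_on K (f \<circ> row 0)" 
    by (intro continuous_on_compose continuous_on_row continuous_on_subset[OF C(2)])
       (auto simp: K_def)
  have ch: "continuous_on K (h \<circ> row 1)" 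
    by (intro continuous_on_compose continuous_on_row continuous_on_subset[OF D(2)])
       (auto simp: K_def)
  define E where "E = {c \<in> K. (g \<circ> (f \<circ> row 0)) c = (h \<circ> row 1) c}"
  have "closed E"
    unfolding E_def 
    by (intro closed_Collect_eq_on K ch continuous_on_compose[OF cf] continuous_on_subset[OF assms(2)]) auto
  moreover have "continuous_on E (f \<circ> row 0)"
    by (rule continuous_on_subset[OF cf]) (auto simp: E_def)
  moreover have "g -` A = (f \<circ> row 0) ` E"
  proof (intro equalityI subsetI)
    fix x assume "x \<in> g -` A"
    then obtain b where b: "b \<in> D" "g x = h b" by (auto simp: D)
    obtain a where a: "a \<in> C" "x = f a" using C(3) by blast
    obtain c where "\<forall>m. row m c = (if m = 0 then a else b)"
      using rows_surj[of "\<lambda>m. if m = 0 then a else b"] by auto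
    then have "row 0 c = a" "row 1 c = b" by auto
    then show "x \<in> (f \<circ> row 0) ` E"
      using a b by (intro image_eqI[of _ _ c]) (auto simp: E_def K_def)
  next
    fix x assume "x \<in> (f \<circ> row 0) ` E"
    then obtain c where c: "c \<in> E" "x = f (row 0 c)" by auto
    then have "g x = h (row 1 c)" "row 1 c \<in> D" unfolding E_def K_def by auto
    then show "x \<in> g -` A" using D(3) by auto
  qed
  ultimately show ?thesis unfolding analytic_set_def by blast
qed

lemma analytic_set_Baire: "analytic_set (UNIV :: (nat \<Rightarrow> nat) set)"
  by (rule analytic_set_closed) simp

lemma analytic_set_Baire_prod: "analytic_set (UNIV :: ((nat \<Rightarrow> nat) \<times> (nat \<Rightarrow> nat)) set)"
proof -
  have "continuous_on UNIV (\<lambda>c. (row 0 c, row 1 c))" by (intro continuous_intros)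
  from analytic_set_image[OF analytic_set_Baire this]
  have "analytic_set (range (\<lambda>c. (row 0 c, row 1 c)))" .
  also have "range (\<lambda>c. (row 0 c, row 1 c)) = UNIV"
  proof (intro equalityI subsetI)
    fix x :: "(nat \<Rightarrow> nat) \<times> (nat \<Rightarrow> nat)"
    obtain c where "\<forall>m. row m c = (if m = 0 then fst x else snd x)"
      using rows_surj[of "\<lambda>m. if m = 0 then fst x else snd x"] by auto
    then have "x = (row 0 c, row 1 c)" by auto
    then show "x \<in> range (\<lambda>c. (row 0 c, row 1 c))" by blast
  qed auto
  finally show ?thesis .
qed

section \<open>Borel sets of sequences are analytic\<close>

definition bianalytic :: "'x::topological_space set \<Rightarrow> bool" where
  "bianalytic A \<longleftrightarrow> analytic_set A \<and> analytic_set (- A)"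

text \<open>Asking for analytic complements as well makes the class symmetric: complements are
  immediate, and a union is treated together with the intersection of the complements.\<close>

lemma sigma_sets_bianalytic:
  fixes \<G> :: "'x::t2_space set set"
  assumes "A \<in> sigma_sets UNIV \<G>" "\<And>G. G \<in> \<G> \<Longrightarrow> bianalytic G"
    and U: "analytic_set (UNIV :: 'x set)"
  shows "bianalytic A"
  using assms(1)
proof induction
  case (Compl a)
  then show ?case by (auto simp: bianalytic_def Compl_eq_Diff_UNIV[symmetric])
next
  case (Union a)
  then show ?case by (auto simp: bianalytic_def intro!: analytic_set_UN analytic_set_INT)
qed (use assms U in \<open>auto simp: bianalytic_def\<close>)

text \<open>The Borel sets are generated by conditions on a single coordinate, which are clopen
  because the naturals are discrete.\<close>

lemma bianalytic_borel_Baire: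
  assumes "A \<in> sets (borel :: (nat \<Rightarrow> nat) measure)" shows "bianalytic A"
proof -
  have "A \<in> sets (PiM UNIV (\<lambda>_::nat. borel :: nat measure))"
    using assms by (simp add: sets_PiM_equal_borel)
  then have "A \<in> sigma_sets UNIV {{f. f i \<in> B} |i B. B \<in> sets (borel :: nat measure)}"
    unfolding sets_PiM_single by (simp add: PiE_UNIV_domain)
  then show ?thesis
  proof (rule sigma_sets_bianalytic)
    fix G :: "(nat \<Rightarrow> nat) set" 
    assume "G \<in> {{f. f i \<in> B} |i B. B \<in> sets (borel :: nat measure)}"
    then obtain i B where G: "G = (\<lambda>f. f i) -` B" by (auto simp: vimage_def)
    have "closed ((\<lambda>f :: nat \<Rightarrow> nat. f i) -` B)" for B
      by (rule closed_vimage) (auto simp: closed_def open_discrete)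
    from this[of B] this[of "-B"] show "bianalytic G"
      by (auto simp: bianalytic_def G vimage_Compl[symmetric] intro!: analytic_set_closed)
  qed (rule analytic_set_Baire)
qed

lemma bianalytic_borel_Baire_prod:
  assumes "A \<in> sets (borel :: ((nat \<Rightarrow> nat) \<times> (nat \<Rightarrow> nat)) measure)" shows "bianalytic A"
proof -
  have "A \<in> sets ((borel :: (nat \<Rightarrow> nat) measure) \<Otimes>\<^sub>M (borel :: (nat \<Rightarrow> nat) measure))"
    by (subst borel_prod) (rule assms)
  then have "A \<in> sigma_sets UNIV {a \<times> b |a b. a \<in> sets (borel :: (nat \<Rightarrow> nat) measure)
      \<and> b \<in> sets (borel :: (nat \<Rightarrow> nat) measure)}"
    by (simp add: sets_pair_measure)
  then show ?thesis
  proof (rule sigma_sets_bianalytic)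
    fix G :: "((nat \<Rightarrow> nat) \<times> (nat \<Rightarrow> nat)) set" 
    assume "G \<in> {a \<times> b |a b. a \<in> sets borel \<and> b \<in> sets borel}"
    then obtain a b where G: "G = a \<times> b" "bianalytic a" "bianalytic b"
      using bianalytic_borel_Baire by auto
    have v: "analytic_set (fst -` c :: ((nat \<Rightarrow> nat) \<times> (nat \<Rightarrow> nat)) set)"
      "analytic_set (snd -` c :: ((nat \<Rightarrow> nat) \<times> (nat \<Rightarrow> nat)) set)"
      if "analytic_set c" for c :: "(nat \<Rightarrow> nat) set"
      using that
      by (simp_all add: analytic_set_vimage analytic_set_Baire_prod continuous_on_fst continuous_on_snd)
    have "G = fst -` a \<inter> snd -` b" "- G = fst -` (-a) \<union> snd -` (- b)" using G by auto
    then show "bianalytic G"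
      using G(2,3) v unfolding bianalytic_def by (simp add: analytic_set_Int analytic_set_Un)
  qed (rule analytic_set_Baire_prod)
qed

section \<open>Lusin separation\<close>

definition cyl :: "nat list \<Rightarrow> (nat \<Rightarrow> nat) set" where
  "cyl s = {c. \<forall>i<length s. c i = s ! i}"

lemma cyl_Nil [simp]: "cyl [] = UNIV"
  by (simp add: cyl_def)

lemma cyl_nonempty: "cyl s \<noteq> {}"
  by (auto simp: cyl_def intro!: exI[of _ "\<lambda>i. s ! i"])

lemma mem_cyl_initial: "c \<in> cyl (map a [0..<n]) \<longleftrightarrow> (\<forall>i<n. c i = a i)"
  by (simp add: cyl_def)

lemma cyl_split: "cyl s = (\<Union>n. cyl (s @ [n]))"
  by (auto simp: cyl_def nth_append less_Suc_eq)

lemma open_contains_cyl: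
  fixes U :: "(nat \<Rightarrow> nat) set"
  assumes "open U" "a \<in> U"
  shows "\<exists>n. cyl (map a [0..<n]) \<subseteq> U"
proof -
  have "openin (product_topology (\<lambda>i::nat. euclidean :: nat topology) UNIV) U"
    using assms by (simp add: open_fun_def)
  from product_topology_open_contains_basis[OF this \<open>a \<in> U\<close>] obtain X where
    X: "a \<in> PiE UNIV X" "finite {i. X i \<noteq> (UNIV :: nat set)}" "PiE UNIV X \<subseteq> U"
    by auto
  obtain n where n: "\<And>i. X i \<noteq> UNIV \<Longrightarrow> i < n"
    using finite_nat_set_iff_bounded X(2) by auto
  have "cyl (map a [0..<n]) \<subseteq> PiE UNIV X"
    using X(1) n by (auto simp: mem_cyl_initial PiE_UNIV_domain Pi_iff) (metis UNIV_I)
  then show ?thesis using X(3) by blast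
qed

lemma cyl_chain_limit:
  assumes "\<And>n. cyl (s (Suc n)) \<subseteq> cyl (s n)" "\<And>n. n \<le> length (s n)"
  shows "\<exists>a. \<forall>n. a \<in> cyl (s n)"
proof (intro exI allI)
  fix n
  \<comment> \<open>Entry \<open>i\<close> is read from word \<open>Suc i\<close>, the first one
    whose length is guaranteed to exceed \<open>i\<close>.\<close>
  show "(\<lambda>i. s (Suc i) ! i) \<in> cyl (s n)"
    unfolding cyl_def
  proof (intro CollectI allI impI)
    fix i assume i: "i < length (s n)"
    have dec: "cyl (s N) \<subseteq> cyl (s m)" if "m \<le> N" for m N
      using lift_Suc_antimono_le[of "\<lambda>n. cyl (s n)"] assms(1) that by blast
    \<comment> \<open>A point in the smaller of the two cylinders extends both words, so they agree
      at entry \<open>i\<close>.\<close>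
    obtain c where "c \<in> cyl (s (max n (Suc i)))" using cyl_nonempty by blast
    then have "c \<in> cyl (s n)" "c \<in> cyl (s (Suc i))" using dec by (meson max.cobounded1 max.cobounded2 subsetD)+
    then show "s (Suc i) ! i = s n ! i"
      using i assms(2)[of "Suc i"] unfolding cyl_def by auto
  qed
qed

text \<open>Cylinders of growing length around \<open>a\<close> form a neighbourhood base. The next
  two lemmas draw the consequences for closed sets and for continuous functions.\<close>

lemma cyl_chain_basis:
  assumes "\<And>n. a \<in> cyl (s n)" "\<And>n. n \<le> length (s n)" "open U" "a \<in> U"
  shows "\<exists>n. cyl (s n) \<subseteq> U"
proof -
  obtain n where n: "cyl (map a [0..<n]) \<subseteq> U" using open_contains_cyl assms by blast
  have "cyl (s n) \<subseteq> cyl (map a [0..<n])"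
    unfolding mem_cyl_initial subset_iff using assms(1,2)[of n] by (auto simp: cyl_def)
  then show ?thesis using n by blast
qed

lemma cyl_chain_closed:
  assumes "\<And>n. a \<in> cyl (s n)" "\<And>n. n \<le> length (s n)" "closed C" "\<And>n. C \<inter> cyl (s n) \<noteq> {}"
  shows "a \<in> C"
  using cyl_chain_basis[of a s "- C"] assms by (metis ComplI disjoint_eq_subset_Compl inf_commute open_Compl)

lemma cyl_chain_continuous:
  assumes "\<And>n. a \<in> cyl (s n)" "\<And>n. n \<le> length (s n)"
    and "continuous_on C f" "a \<in> C" "open U" "f a \<in> U"
  shows "\<exists>n. f ` (C \<inter> cyl (s n)) \<subseteq> U"
proof -
  obtain A where A: "open A" "a \<in> A" "\<And>c. c \<in> C \<Longrightarrow> c \<in> A \<Longrightarrow> f c \<in> U"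
    using assms(3-6) unfolding continuous_on_topological by metis
  then obtain n where "cyl (s n) \<subseteq> A" using cyl_chain_basis assms by blast
  then show ?thesis using A(3) by blast
qed

definition borel_separated :: "'x::topological_space set \<Rightarrow> 'x set \<Rightarrow> bool" where
  "borel_separated A B \<longleftrightarrow> (\<exists>D\<in>sets borel. A \<subseteq> D \<and> D \<inter> B = {})"

text \<open>For fixed \<open>m\<close> the separators are intersected over \<open>n\<close>, then
  united over \<open>m\<close>. Read contrapositively, non-separation passes from two cylinders to a
  pair of subcylinders.\<close>

lemma borel_separated_UN:
  fixes A B :: "nat \<Rightarrow> 'x::topological_space set"
  assumes "\<And>m n. borel_separated (A m) (B n)"
  shows "borel_separated (\<Union>m. A m) (\<Union>n. B n)"
proof -
  obtain D where D: "\<And>m n. D m n \<in> sets borel" "\<And>m n. A m \<subseteq> D m n" "\<And>m n. D m n \<inter> B n = {}"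
    using assms unfolding borel_separated_def by metis
  have "(\<Union>m. \<Inter>n. D m n) \<in> sets borel"
    using D(1) by (intro sets.countable_UN sets.countable_INT) auto
  moreover have "(\<Union>m. A m) \<subseteq> (\<Union>m. \<Inter>n. D m n)" using D(2) by blast
  moreover have "(\<Union>m. \<Inter>n. D m n) \<inter> (\<Union>n. B n) = {}" using D(3) by blast
  ultimately show ?thesis unfolding borel_separated_def by blast
qed

text \<open>If no Borel set separates, non-separation descends through ever longer pairs of words.
  The limits have distinct images, and disjoint open sets around these do separate a late
  pair.\<close>

theorem lusin_separation:
  fixes A B :: "'x::t2_space set"
  assumes "analytic_set A" "analytic_set B" "A \<inter> B = {}"
  shows "borel_separated A B"
proof (rule ccontr)
  assume contra: "\<not> borel_separated A B"
  obtain C :: "(nat \<Rightarrow> nat) set" and f where C: "closed C" "continuous_on C f" "A = f ` C"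
    using assms by (auto simp: analytic_set_def)
  obtain D :: "(nat \<Rightarrow> nat) set" and g where D: "closed D" "continuous_on D g" "B = g ` D"
    using assms by (auto simp: analytic_set_def)
  define P where "P n p \<longleftrightarrow> length (fst p) = n \<and> length (snd p) = n \<and>
      \<not> borel_separated (f ` (C \<inter> cyl (fst p))) (g ` (D \<inter> cyl (snd p)))" for n :: nat and p
  have "\<exists>p. P 0 p" using contra by (intro exI[of _ "([], [])"]) (simp add: P_def C D)
  moreover have "\<exists>q. P (Suc n) q \<and> cyl (fst q) \<subseteq> cyl (fst p) \<and> cyl (snd q) \<subseteq> cyl (snd p)"
    if "P n p" for p n
  proof -
    have eqs: "f ` (C \<inter> cyl (fst p)) = (\<Union>i. f ` (C \<inter> cyl (fst p @ [i])))"
      "g ` (D \<inter> cyl (snd p)) = (\<Union>j. g ` (D \<inter> cyl (snd p @ [j])))"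
      using cyl_split[of "fst p"] cyl_split[of "snd p"] by auto
    have "\<not> borel_separated (\<Union>i. f ` (C \<inter> cyl (fst p @ [i]))) (\<Union>j. g ` (D \<inter> cyl (snd p @ [j])))"
      using \<open>P n p\<close> unfolding P_def eqs by blast
    then obtain i j where
      "\<not> borel_separated (f ` (C \<inter> cyl (fst p @ [i]))) (g ` (D \<inter> cyl (snd p @ [j])))"
      using borel_separated_UN[of "\<lambda>i. f ` (C \<inter> cyl (fst p @ [i]))" "\<lambda>j. g ` (D \<inter> cyl (snd p @ [j]))"]
      by blast
    then show ?thesis
      using cyl_split[of "fst p"] cyl_split[of "snd p"] \<open>P n p\<close>
      by (intro exI[of _ "(fst p @ [i], snd p @ [j])"]) (auto simp: P_def)
  qed
  ultimately obtain p where p: "\<And>n. P n (p n)" 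
      "\<And>n. cyl (fst (p (Suc n))) \<subseteq> cyl (fst (p n)) \<and> cyl (snd (p (Suc n))) \<subseteq> cyl (snd (p n))"
    using dependent_nat_choice[of P "\<lambda>_ p q. cyl (fst q) \<subseteq> cyl (fst p) \<and> cyl (snd q) \<subseteq> cyl (snd p)"]
    by metis
  have len: "n \<le> length (fst (p n))" "n \<le> length (snd (p n))" for n
    using p(1)[of n] by (auto simp: P_def)
  obtain a b where a: "\<And>n. a \<in> cyl (fst (p n))" and b: "\<And>n. b \<in> cyl (snd (p n))"
    using cyl_chain_limit[of "\<lambda>n. fst (p n)"] cyl_chain_limit[of "\<lambda>n. snd (p n)"] p(2) len by metis
  have ns: "\<not> borel_separated (f ` (C \<inter> cyl (fst (p n)))) (g ` (D \<inter> cyl (snd (p n))))" for n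
    using p(1)[of n] by (auto simp: P_def)
  \<comment> \<open>An empty set is always separated, by \<open>{}\<close> or by the whole space, so
    both cylinders meet their closed domains.\<close>
  have "C \<inter> cyl (fst (p n)) \<noteq> {}" "D \<inter> cyl (snd (p n)) \<noteq> {}" for n
    using ns[of n] unfolding borel_separated_def
    by (metis Int_empty_left empty_subsetI image_empty sets.empty_sets,
        metis Int_empty_right image_empty subset_UNIV sets.top space_borel)
  then have "a \<in> C" "b \<in> D"
    using cyl_chain_closed[of a "\<lambda>n. fst (p n)" C] cyl_chain_closed[of b "\<lambda>n. snd (p n)" D] a b len C D by auto
  then have "f a \<noteq> g b" using assms(3) C D by blast
  then obtain U V where UV: "open U" "open V" "f a \<in> U" "g b \<in> V" "U \<inter> V = {}"
    by (meson hausdorff)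
  obtain n where n: "f ` (C \<inter> cyl (fst (p n))) \<subseteq> U"
    using cyl_chain_continuous[of a "\<lambda>n. fst (p n)" C f U] a len C \<open>a \<in> C\<close> UV by auto
  obtain m where m: "g ` (D \<inter> cyl (snd (p m))) \<subseteq> V"
    using cyl_chain_continuous[of b "\<lambda>n. snd (p n)" D g V] b len D \<open>b \<in> D\<close> UV by auto
  have dec: "cyl (fst (p (max n m))) \<subseteq> cyl (fst (p n))" "cyl (snd (p (max n m))) \<subseteq> cyl (snd (p m))"
    using lift_Suc_antimono_le[of "\<lambda>n. cyl (fst (p n))"] lift_Suc_antimono_le[of "\<lambda>n. cyl (snd (p n))"] p(2)
    by (meson max.cobounded1 max.cobounded2)+
  have "borel_separated (f ` (C \<inter> cyl (fst (p (max n m))))) (g ` (D \<inter> cyl (snd (p (max n m)))))"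
    unfolding borel_separated_def
  proof (intro bexI[of _ U] conjI)
    show "f ` (C \<inter> cyl (fst (p (max n m)))) \<subseteq> U" using n dec by blast
    show "U \<inter> g ` (D \<inter> cyl (snd (p (max n m)))) = {}" using m dec UV(5) by blast
  qed (use UV in auto)
  then show False using ns by blast
qed

text \<open>Induction: \<open>D\<close> separates one set from the intersection of the others. These
  are treated inside \<open>D\<close>, where \<open>borel_analytic\<close> keeps them analytic, and
  adding \<open>- D\<close> restores what was cut off.\<close>

lemma lusin_separation_finite:
  fixes X :: "'i \<Rightarrow> 'x::t2_space set"
  assumes "finite I" "I \<noteq> {}" "\<And>i. i \<in> I \<Longrightarrow> analytic_set (X i)" "(\<Inter>i\<in>I. X i) = {}"
    and borel_analytic: "\<And>D :: 'x set. D \<in> sets borel \<Longrightarrow> analytic_set D"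
  shows "\<exists>B. (\<forall>i\<in>I. B i \<in> sets borel \<and> X i \<subseteq> B i) \<and> (\<Inter>i\<in>I. B i) = {}"
  using assms(1-4)
proof (induction arbitrary: X rule: finite_ne_induct)
  case (singleton i)
  then show ?case by (intro exI[of _ "\<lambda>_. {}"]) auto
next
  case (insert i I)
  have "borel_separated (X i) (\<Inter>j\<in>I. X j)"
    using insert by (intro lusin_separation analytic_set_INT_finite) auto
  then obtain D where D: "D \<in> sets borel" "X i \<subseteq> D" "D \<inter> (\<Inter>j\<in>I. X j) = {}"
    unfolding borel_separated_def by blast
  have "\<exists>B. (\<forall>j\<in>I. B j \<in> sets borel \<and> X j \<inter> D \<subseteq> B j) \<and> (\<Inter>j\<in>I. B j) = {}"
    using insert.prems(1) D borel_analytic insert.hyps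
    by (intro insert.IH) (auto intro!: analytic_set_Int)
  then obtain B where B: "\<And>j. j \<in> I \<Longrightarrow> B j \<in> sets borel \<and> X j \<inter> D \<subseteq> B j" "(\<Inter>j\<in>I. B j) = {}"
    by blast
  show ?case
  proof (intro exI[of _ "\<lambda>j. if j = i then D else B j \<union> - D"] conjI ballI)
    fix j assume "j \<in> insert i I"
    then show "(if j = i then D else B j \<union> - D) \<in> sets borel"
      using D(1) B(1) by (auto intro: borel_comp)
    show "X j \<subseteq> (if j = i then D else B j \<union> - D)"
      using \<open>j \<in> insert i I\<close> D(2) B(1) by auto
  next
    show "(\<Inter>j\<in>insert i I. if j = i then D else B j \<union> - D) = {}"
      using B(2) insert.hyps(3) by auto
  qed
qed

section \<open>Analytic partial functions\<close>

lemma measurable_Baire_iff: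
  "f \<in> M \<rightarrow>\<^sub>M (borel :: (nat \<Rightarrow> nat) measure) \<longleftrightarrow> (\<forall>n. (\<lambda>x. f x n) \<in> M \<rightarrow>\<^sub>M count_space UNIV)"
proof -
  have *: "M \<rightarrow>\<^sub>M (borel :: nat measure) = M \<rightarrow>\<^sub>M count_space UNIV"
    by (rule measurable_cong_sets) (simp_all add: sets_borel_eq_count_space)
  show ?thesis
    using measurable_product_then_coordinatewise[of f M] measurable_coordinatewise_then_product[of f M]
    unfolding * by blast
qed

text \<open>Two sequences differ exactly when some entry tells them apart, so slices express
  single-valuedness through countably many projections, which stay analytic.\<close>

definition Baire_slice :: "((nat \<Rightarrow> nat) \<times> (nat \<Rightarrow> nat)) set \<Rightarrow> nat \<Rightarrow> nat set \<Rightarrow> (nat \<Rightarrow> nat) set" where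
  "Baire_slice A n J = fst ` (A \<inter> {p. snd p n \<in> J})"

lemma analytic_set_Baire_slice:
  assumes "analytic_set A"
  shows "analytic_set (Baire_slice A n J)"
proof -
  have cl: "continuous_on UNIV (\<lambda>p :: (nat \<Rightarrow> nat) \<times> (nat \<Rightarrow> nat). snd p n)"
    by (rule continuous_on_product_then_coordinatewise[OF continuous_on_snd[OF continuous_on_id]])
  have "open ((\<lambda>p :: (nat \<Rightarrow> nat) \<times> (nat \<Rightarrow> nat). snd p n) -` J)"
    by (rule open_vimage[OF _ cl]) (simp add: open_discrete)
  then have "{p :: (nat \<Rightarrow> nat) \<times> (nat \<Rightarrow> nat). snd p n \<in> J} \<in> sets borel"
    by (simp add: vimage_def)
  then have "analytic_set {p :: (nat \<Rightarrow> nat) \<times> (nat \<Rightarrow> nat). snd p n \<in> J}"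
    using bianalytic_borel_Baire_prod bianalytic_def by blast
  then show ?thesis
    unfolding Baire_slice_def
    by (rule analytic_set_image[OF analytic_set_Int[OF assms]]) (rule continuous_on_fst[OF continuous_on_id])
qed

text \<open>\<open>B n j\<close> separates the points whose value has \<open>n\<close>-th entry \<open>j\<close> from the others, so \<open>LEAST\<close>
  reads off the value on the domain of \<open>A\<close> and is junk, but measurable, elsewhere.\<close>

lemma analytic_function_extends:
  fixes A :: "((nat \<Rightarrow> nat) \<times> (nat \<Rightarrow> nat)) set"
  assumes "analytic_set A" "single_valued A"
  shows "\<exists>f \<in> borel_measurable borel. \<forall>x y. (x, y) \<in> A \<longrightarrow> y = f x"
proof -
  have "borel_separated (Baire_slice A n {j}) (Baire_slice A n (-{j}))" for n j
  proof (rule lusin_separation)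
    show "Baire_slice A n {j} \<inter> Baire_slice A n (-{j}) = {}"
      using assms(2) by (auto simp: Baire_slice_def dest: single_valuedD)
  qed (rule analytic_set_Baire_slice[OF assms(1)])+
  then obtain B where B: "\<And>n j. B n j \<in> sets borel" "\<And>n j. Baire_slice A n {j} \<subseteq> B n j"
      "\<And>n j. B n j \<inter> Baire_slice A n (-{j}) = {}"
    unfolding borel_separated_def by metis
  define f where "f x n = (LEAST j. x \<in> B n j)" for x n
  have "f \<in> borel_measurable borel"
    unfolding measurable_Baire_iff
  proof
    fix n
    have "Measurable.pred borel (\<lambda>x. x \<in> B n j)" for j
      using B(1) by (simp add: pred_def)
    then show "(\<lambda>x. f x n) \<in> borel \<rightarrow>\<^sub>M count_space UNIV"
      unfolding f_def by (rule measurable_Least)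
  qed
  moreover have "y = f x" if "(x, y) \<in> A" for x y
  proof
    fix n
    have "x \<in> Baire_slice A n J" if "y n \<in> J" for J
      using \<open>(x, y) \<in> A\<close> that by (force simp: Baire_slice_def)
    then have "x \<in> B n j \<longleftrightarrow> j = y n" for j
      using B(2)[of n j] B(3)[of n j] by (cases "j = y n") auto
    then show "y n = f x n" unfolding f_def by (simp add: Least_equality)
  qed
  ultimately show ?thesis by blast
qed

section \<open>Graphs of Borel functions and splitting of cylinders\<close>

definition graphs :: "('x \<Rightarrow> 'y) set \<Rightarrow> ('x \<times> 'y) set" where
  "graphs F = {(x, y). \<exists>f\<in>F. y = f x}"

lemma graphs_mono: "F \<subseteq> F' \<Longrightarrow> graphs F \<subseteq> graphs F'"
  unfolding graphs_def by blast

text \<open>Each graph is the preimage of the closed diagonal under the Borel map sending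
  \<open>(x, y)\<close> to \<open>(f x, y)\<close>.\<close>

lemma graphs_borel:
  assumes "countable F" "F \<subseteq> borel_measurable borel"
  shows "graphs F \<in> sets (borel :: ('x::second_countable_topology \<times> 'y::{second_countable_topology,t2_space}) measure)"
proof -
  have "{p :: 'x \<times> 'y. snd p = f (fst p)} \<in> sets borel" if "f \<in> F" for f
  proof -
    have [measurable]: "f \<in> borel_measurable borel" using that assms by auto
    have m: "(\<lambda>p. (f (fst p), snd p)) \<in> (borel :: ('x \<times> 'y) measure) \<rightarrow>\<^sub>M borel"
      unfolding borel_prod[symmetric] by measurable
    have "closed {p :: 'y \<times> 'y. fst p = snd p}"
      using closed_diagonal[where 'a='y] by (simp add: split_beta' Collect_case_prod[symmetric] closed_Collect_eq continuous_on_fst continuous_on_snd continuous_on_id)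
    then have "(\<lambda>p. (f (fst p), snd p)) -` {p :: 'y \<times> 'y. fst p = snd p} \<inter> space (borel :: ('x \<times> 'y) measure) \<in> sets borel"
      by (intro measurable_sets[OF m]) simp
    also have "(\<lambda>p. (f (fst p), snd p)) -` {p :: 'y \<times> 'y. fst p = snd p} \<inter> space (borel :: ('x \<times> 'y) measure)
      = {p :: 'x \<times> 'y. snd p = f (fst p)}" by auto
    finally show ?thesis .
  qed
  then have "(\<Union>f\<in>F. {p :: 'x \<times> 'y. snd p = f (fst p)}) \<in> sets borel"
    using assms(1) by (intro sets.countable_UN') auto
  also have "(\<Union>f\<in>F. {p :: 'x \<times> 'y. snd p = f (fst p)}) = graphs F"
    by (auto simp: graphs_def)
  finally show ?thesis .
qed

text \<open>By continuity, small cylinders around \<open>b\<close> and \<open>b'\<close> are mapped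
  into disjoint neighbourhoods. The bound \<open>k\<close> will force the words to grow along the
  binary tree built later.\<close>

lemma split_cylinders:
  fixes f :: "(nat \<Rightarrow> nat) \<Rightarrow> 'y::t2_space"
  assumes f: "continuous_on C f" and b: "b \<in> C \<inter> cyl s" "b' \<in> C \<inter> cyl s" "f b \<noteq> f b'"
  shows "\<exists>t t'. b \<in> cyl t \<and> b' \<in> cyl t' \<and> k \<le> length t \<and> k \<le> length t' \<and>
    cyl t \<subseteq> cyl s \<and> cyl t' \<subseteq> cyl s \<and> f ` (C \<inter> cyl t) \<inter> f ` (C \<inter> cyl t') = {}"
proof -
  obtain U V where UV: "open U" "open V" "f b \<in> U" "f b' \<in> V" "U \<inter> V = {}"
    using b(3) by (meson hausdorff)
  have init: "a \<in> cyl (map a [0..<n])" for a n by (simp add: mem_cyl_initial)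
  obtain m where m: "f ` (C \<inter> cyl (map b [0..<m])) \<subseteq> U"
    using cyl_chain_continuous[of b "\<lambda>n. map b [0..<n]" C f U] init f b UV by auto
  obtain m' where m': "f ` (C \<inter> cyl (map b' [0..<m'])) \<subseteq> V"
    using cyl_chain_continuous[of b' "\<lambda>n. map b' [0..<n]" C f V] init f b UV by auto
  \<comment> \<open>Long enough for both continuity bounds and for \<open>k\<close>, and at least as
    long as \<open>s\<close>, so that the new cylinders lie inside that of \<open>s\<close>.\<close>
  define N where "N = Max {m, m', k, length s}"
  have N: "m \<le> N" "m' \<le> N" "k \<le> N" "length s \<le> N" unfolding N_def by auto
  have sub: "cyl (map a [0..<N]) \<subseteq> cyl s" if "a \<in> cyl s" for a
    unfolding subset_iff mem_cyl_initial using that N(4) by (auto simp: cyl_def)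
  have sub': "cyl (map a [0..<N]) \<subseteq> cyl (map a [0..<j])" if "j \<le> N" for a j
    unfolding subset_iff mem_cyl_initial using that by auto
  have "f ` (C \<inter> cyl (map b [0..<N])) \<subseteq> U" "f ` (C \<inter> cyl (map b' [0..<N])) \<subseteq> V"
    using m m' sub'[OF N(1), of b] sub'[OF N(2), of b'] by blast+
  then have "f ` (C \<inter> cyl (map b [0..<N])) \<inter> f ` (C \<inter> cyl (map b' [0..<N])) = {}"
    using UV(5) by blast
  then show ?thesis
    using init sub N(3) b
    by (intro exI[of _ "map b [0..<N]"] exI[of _ "map b' [0..<N]"]) simp
qed

section \<open>The Lusin--Novikov theorem\<close>

text \<open>Stated on Baire space, to which standard Borel spaces are reduced afterwards by coding.
  The contradiction is an uncountable section.\<close>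

theorem lusin_novikov_cover:
  fixes R :: "((nat \<Rightarrow> nat) \<times> (nat \<Rightarrow> nat)) set"
  assumes "analytic_set R" and countable_sections: "\<And>x. countable (R `` {x})"
  shows "\<exists>F. countable F \<and> F \<subseteq> borel_measurable borel \<and> R \<subseteq> graphs F"
proof (rule ccontr)
  assume contra: "\<not> ?thesis"
  obtain C and \<phi> :: "(nat \<Rightarrow> nat) \<Rightarrow> (nat \<Rightarrow> nat) \<times> (nat \<Rightarrow> nat)" where
    C: "closed C" "continuous_on C \<phi>" "R = \<phi> ` C"
    using assms(1) unfolding analytic_set_def by blast
  define adm :: "((nat \<Rightarrow> nat) \<Rightarrow> (nat \<Rightarrow> nat)) set \<Rightarrow> bool" where
    "adm F \<longleftrightarrow> countable F \<and> F \<subseteq> borel_measurable borel" for F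
  \<comment> \<open>Parameters over \<open>x\<close> that \<open>F\<close> leaves uncovered. In
    terms of these, \<open>compat F W\<close> says that \<open>F\<close> does not kill
    \<open>W\<close>, and \<open>split F W\<close> that every cylinder of \<open>W\<close> still
    offers two values over one common \<open>x\<close>.\<close>
  define pts where "pts F s x = {b \<in> C \<inter> cyl s. fst (\<phi> b) = x \<and> \<phi> b \<notin> graphs F}" for F s x
  define compat where "compat F W \<longleftrightarrow> (\<exists>x. \<forall>s\<in>W. pts F s x \<noteq> {})" for F W
  define split where "split F W \<longleftrightarrow>
    (\<exists>x. \<forall>s\<in>W. \<exists>b b'. b \<in> pts F s x \<and> b' \<in> pts F s x \<and> snd (\<phi> b) \<noteq> snd (\<phi> b'))" for F W
  \<comment> \<open>Without a splitting, the sets of points with two uncovered values have Borel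
    hulls \<open>B s\<close> with empty intersection. Every \<open>x\<close> escapes some hull, and
    there the uncovered value from that cylinder is unique, hence caught by a Borel
    function.\<close>
  have kill: "\<exists>F'. adm F' \<and> \<not> compat (F \<union> F') W"
    if W: "finite W" "W \<noteq> {}" and "adm F" "\<not> split F W" for F W
  proof -
    define A where "A s = \<phi> ` (C \<inter> cyl s) - graphs F" for s
    have an: "analytic_set (A s)" for s
    proof -
      have "closed (cyl s)"
      proof -
        have "cyl s = (\<Inter>i\<in>{..<length s}. (\<lambda>c. c i) -` {s ! i})" by (auto simp: cyl_def)
        also have "closed \<dots>" by (intro closed_INT ballI closed_vimage) auto
        finally show ?thesis .
      qed
      then have "analytic_set (\<phi> ` (C \<inter> cyl s))"
        using C by (intro analytic_set_image analytic_set_closed closed_Int) (auto intro: continuous_on_subset)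
      moreover have "analytic_set (- graphs F)"
        using graphs_borel bianalytic_borel_Baire_prod \<open>adm F\<close> unfolding adm_def bianalytic_def by blast
      ultimately show ?thesis unfolding A_def Diff_eq by (rule analytic_set_Int)
    qed
    \<comment> \<open>Two values differ when some entry is \<open>j\<close> for one and not for the
      other; this makes the set of points with two uncovered values analytic.\<close>
    define X where "X s = (\<Union>n. \<Union>j. Baire_slice (A s) n {j} \<inter> Baire_slice (A s) n (-{j}))" for s
    have X: "x \<in> X s" if xy: "(x, y) \<in> A s" "(x, y') \<in> A s" "y \<noteq> y'" for x y y' s
    proof -
      obtain n where "y n \<noteq> y' n" using xy(3) by auto
      then have "x \<in> Baire_slice (A s) n {y n}" "x \<in> Baire_slice (A s) n (- {y n})"
        using xy by (force simp: Baire_slice_def)+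
      then show ?thesis unfolding X_def by blast
    qed
    have "(\<Inter>s\<in>W. X s) = {}"
    proof (rule ccontr)
      assume "(\<Inter>s\<in>W. X s) \<noteq> {}"
      then obtain x where x: "\<And>s. s \<in> W \<Longrightarrow> x \<in> X s" by blast
      have "\<exists>b b'. b \<in> pts F s x \<and> b' \<in> pts F s x \<and> snd (\<phi> b) \<noteq> snd (\<phi> b')" if s: "s \<in> W" for s
      proof -
        obtain n j where "x \<in> Baire_slice (A s) n {j}" "x \<in> Baire_slice (A s) n (-{j})"
          using x[OF s] unfolding X_def by blast
        then obtain p p' where p: "p \<in> A s" "p' \<in> A s" "fst p = x" "fst p' = x" "snd p n = j" "snd p' n \<noteq> j"
          by (auto simp: Baire_slice_def)
        then obtain b b' where "p = \<phi> b" "p' = \<phi> b'" "b \<in> C \<inter> cyl s" "b' \<in> C \<inter> cyl s" "p \<notin> graphs F" "p' \<notin> graphs F"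
          unfolding A_def by blast
        then show ?thesis
          unfolding pts_def using p by (intro exI[of _ b] exI[of _ b']) auto
      qed
      then show False using \<open>\<not> split F W\<close> unfolding split_def by blast
    qed
    moreover have "analytic_set (X s)" for s
      unfolding X_def by (intro analytic_set_UN analytic_set_Int analytic_set_Baire_slice an)
    moreover have "analytic_set D" if "D \<in> sets borel" for D :: "(nat \<Rightarrow> nat) set"
      using that bianalytic_borel_Baire bianalytic_def by blast
    ultimately obtain B where B: "\<And>s. s \<in> W \<Longrightarrow> B s \<in> sets borel" "\<And>s. s \<in> W \<Longrightarrow> X s \<subseteq> B s"
        "(\<Inter>s\<in>W. B s) = {}"
      using lusin_separation_finite[of W X] W by metis
    have "\<exists>f\<in>borel_measurable borel. \<forall>x y. (x, y) \<in> A s \<and> x \<notin> B s \<longrightarrow> y = f x" if "s \<in> W" for s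
    proof -
      have "analytic_set (- B s)"
        using bianalytic_borel_Baire[OF B(1)[OF that]] unfolding bianalytic_def by blast
      then have "analytic_set (fst -` (- B s) :: ((nat \<Rightarrow> nat) \<times> (nat \<Rightarrow> nat)) set)"
        by (intro analytic_set_vimage analytic_set_Baire_prod continuous_on_fst continuous_on_id)
      then have "analytic_set (A s \<inter> fst -` (- B s))" using an by (intro analytic_set_Int)
      moreover have "single_valued (A s \<inter> fst -` (- B s))"
        using X B(2)[OF that] unfolding single_valued_def by auto blast
      ultimately show ?thesis using analytic_function_extends[of "A s \<inter> fst -` (- B s)"] by auto
    qed
    then obtain f where f: "\<And>s. s \<in> W \<Longrightarrow> f s \<in> borel_measurable borel"
        "\<And>s x y. s \<in> W \<Longrightarrow> (x, y) \<in> A s \<Longrightarrow> x \<notin> B s \<Longrightarrow> y = f s x"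
      by metis
    have "\<not> compat (F \<union> f ` W) W"
    proof
      assume "compat (F \<union> f ` W) W"
      then obtain x where x: "\<And>s. s \<in> W \<Longrightarrow> pts (F \<union> f ` W) s x \<noteq> {}" unfolding compat_def by blast
      obtain s where s: "s \<in> W" "x \<notin> B s" using B(3) by blast
      obtain b where b: "b \<in> C \<inter> cyl s" "fst (\<phi> b) = x" "\<phi> b \<notin> graphs (F \<union> f ` W)"
        using x[OF s(1)] unfolding pts_def by blast
      have "\<phi> b = (x, snd (\<phi> b))" using b(2) by (metis prod.collapse)
      moreover have "\<phi> b \<in> A s" using b graphs_mono[of F "F \<union> f ` W"] unfolding A_def by blast
      ultimately have "snd (\<phi> b) = f s x" using f(2)[OF s(1) _ s(2)] by metis
      then have "\<phi> b \<in> graphs (F \<union> f ` W)"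
        using s(1) b(2) unfolding graphs_def by (auto simp: split_beta)
      then show False using b(3) by simp
    qed
    moreover have "adm (f ` W)" using f(1) that(1) unfolding adm_def by (auto simp: countable_finite)
    ultimately show ?thesis by blast
  qed
  have mono: "compat F W" if "compat F' W" "F \<subseteq> F'" for F F' W
  proof -
    have "graphs F \<subseteq> graphs F'" using that(2) by (rule graphs_mono)
    then have "pts F' s x \<subseteq> pts F s x" for s x unfolding pts_def by auto
    then show ?thesis using that(1) unfolding compat_def by (metis subset_empty)
  qed
  \<comment> \<open>One killing family is chosen for each \<open>W\<close> that has one; the default
    \<open>{}\<close> is admissible too.\<close>
  define K where "K W = (if \<exists>F. adm F \<and> \<not> compat F W then SOME F. adm F \<and> \<not> compat F W else {})" for W
  have K: "adm (K W)" "(\<exists>F. adm F \<and> \<not> compat F W) \<Longrightarrow> \<not> compat (K W) W" for W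
    unfolding K_def using someI_ex[of "\<lambda>F. adm F \<and> \<not> compat F W"] by (auto simp: adm_def)
  \<comment> \<open>There are only countably many finite sets of words, so \<open>G\<close> is still
    countable.\<close>
  define G where "G = (\<Union>W\<in>Collect finite. K W)"
  have "adm G"
    using K(1) unfolding G_def adm_def by (auto intro!: countable_UN countable_Collect_finite)
  \<comment> \<open>Otherwise \<open>kill\<close> yields an admissible family killing
    \<open>W\<close>. Then \<open>K W\<close> kills \<open>W\<close> as well, and being part of
    \<open>G\<close> it contradicts \<open>mono\<close>.\<close>
  have split: "split G W" if W: "finite W" "W \<noteq> {}" and comp: "compat G W" for W
  proof (rule ccontr)
    assume "\<not> split G W"
    then obtain F where F: "adm F" "\<not> compat (G \<union> F) W"
      using kill[OF W \<open>adm G\<close>] by blast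
    then have "adm (G \<union> F)" using \<open>adm G\<close> unfolding adm_def by auto
    then have "\<not> compat (K W) W" using K(2) F(2) by blast
    moreover have "K W \<subseteq> G" using W(1) unfolding G_def by blast
    ultimately show False using mono[OF comp] by blast
  qed
  have "compat G {[]}"
  proof -
    have "\<not> R \<subseteq> graphs G" using contra \<open>adm G\<close> unfolding adm_def by blast
    then obtain b where "b \<in> C" "\<phi> b \<notin> graphs G" using C(3) by blast
    then show ?thesis unfolding compat_def pts_def by auto
  qed
  define lev where "lev n = {l :: bool list. length l = n}" for n
  have lev: "finite (lev n)" "lev n \<noteq> {}" for n
    unfolding lev_def using finite_lists_length_eq[of "UNIV :: bool set" n] Ex_list_of_length[of n] by auto
  \<comment> \<open>\<open>\<sigma>\<close> places a word at each node of level \<open>n\<close> of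
    the binary tree. One \<open>x\<close> must serve all nodes of a level, but it may change from
    level to level.\<close>
  define P where "P n \<sigma> \<longleftrightarrow> compat G (\<sigma> ` lev n) \<and> (\<forall>l\<in>lev n. n \<le> length (\<sigma> l))"
    for n and \<sigma> :: "bool list \<Rightarrow> nat list"
  define Q where "Q n \<sigma> \<tau> \<longleftrightarrow> (\<forall>l\<in>lev n. (\<forall>v. cyl (\<tau> (v # l)) \<subseteq> cyl (\<sigma> l)) \<and>
      (snd \<circ> \<phi>) ` (C \<inter> cyl (\<tau> (True # l))) \<inter> (snd \<circ> \<phi>) ` (C \<inter> cyl (\<tau> (False # l))) = {})"
    for n and \<sigma> \<tau> :: "bool list \<Rightarrow> nat list"
  have cont: "continuous_on C (snd \<circ> \<phi>)" "continuous_on C (fst \<circ> \<phi>)"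
    using C(2) by (auto intro: continuous_on_snd continuous_on_fst simp: o_def)
  have "\<exists>\<sigma>. P 0 \<sigma>"
    using \<open>compat G {[]}\<close> by (intro exI[of _ "\<lambda>_. []"]) (simp add: P_def lev_def)
  moreover have "\<exists>\<tau>. P (Suc n) \<tau> \<and> Q n \<sigma> \<tau>" if "P n \<sigma>" for n \<sigma>
  proof -
    have "split G (\<sigma> ` lev n)" using that lev by (intro split) (auto simp: P_def)
    then obtain x where x: "\<And>l. l \<in> lev n \<Longrightarrow> \<exists>b b'. b \<in> pts G (\<sigma> l) x \<and> b' \<in> pts G (\<sigma> l) x \<and>
        snd (\<phi> b) \<noteq> snd (\<phi> b')"
      unfolding split_def by blast
    define good where "good l t t' \<longleftrightarrow> Suc n \<le> length t \<and> Suc n \<le> length t' \<and>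
        cyl t \<subseteq> cyl (\<sigma> l) \<and> cyl t' \<subseteq> cyl (\<sigma> l) \<and>
        (snd \<circ> \<phi>) ` (C \<inter> cyl t) \<inter> (snd \<circ> \<phi>) ` (C \<inter> cyl t') = {} \<and>
        pts G t x \<noteq> {} \<and> pts G t' x \<noteq> {}" for l t t'
    have "\<exists>t t'. good l t t'" if l: "l \<in> lev n" for l
    proof -
      obtain b b' where b: "b \<in> pts G (\<sigma> l) x" "b' \<in> pts G (\<sigma> l) x" "snd (\<phi> b) \<noteq> snd (\<phi> b')"
        using x[OF l] by blast
      have "b \<in> C \<inter> cyl (\<sigma> l)" "b' \<in> C \<inter> cyl (\<sigma> l)" "(snd \<circ> \<phi>) b \<noteq> (snd \<circ> \<phi>) b'"
        using b by (auto simp: pts_def)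
      from split_cylinders[where f="snd \<circ> \<phi>" and C=C and b=b and b'=b' and s="\<sigma> l" and k="Suc n", OF cont(1) this]
      obtain t t' where
        t: "b \<in> cyl t" "b' \<in> cyl t'" "Suc n \<le> length t" "Suc n \<le> length t'" "cyl t \<subseteq> cyl (\<sigma> l)" "cyl t' \<subseteq> cyl (\<sigma> l)"
          "(snd \<circ> \<phi>) ` (C \<inter> cyl t) \<inter> (snd \<circ> \<phi>) ` (C \<inter> cyl t') = {}"
        by blast
      moreover have "b \<in> pts G t x" "b' \<in> pts G t' x" using b t(1,2) by (auto simp: pts_def)
      ultimately have "good l t t'" unfolding good_def by blast
      then show ?thesis by blast
    qed
    then obtain t t' where t: "\<And>l. l \<in> lev n \<Longrightarrow> good l (t l) (t' l)"
      by metis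
    \<comment> \<open>Bits are added in front: \<open>tl l\<close> is the parent node, and
      \<open>hd l\<close> selects one of its two halves.\<close>
    define \<tau> where "\<tau> l = (if hd l then t (tl l) else t' (tl l))" for l
    have lev_Suc: "tl l \<in> lev n" if "l \<in> lev (Suc n)" for l
      using that by (auto simp: lev_def)
    have *: "Suc n \<le> length (\<tau> l) \<and> pts G (\<tau> l) x \<noteq> {}" if "l \<in> lev (Suc n)" for l
      using t[OF lev_Suc[OF that]] unfolding good_def \<tau>_def by simp
    then have "P (Suc n) \<tau>"
      unfolding P_def compat_def by blast
    moreover have "Q n \<sigma> \<tau>"
      using t unfolding Q_def \<tau>_def good_def by simp
    ultimately show ?thesis by blast
  qed
  ultimately obtain \<sigma> where \<sigma>: "\<And>n. P n (\<sigma> n)" "\<And>n. Q n (\<sigma> n) (\<sigma> (Suc n))"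
    using dependent_nat_choice[of P Q] by blast
  \<comment> \<open>Reversed, so that the newest bit stands in front, as \<open>Q\<close>
    expects.\<close>
  define path where "path c n = rev (map c [0..<n])" for c :: "nat \<Rightarrow> bool" and n
  have path_Suc: "path c (Suc n) = c n # path c n" and path_lev: "path c n \<in> lev n" for c n
    by (auto simp: path_def lev_def)
  define w where "w c n = \<sigma> n (path c n)" for c n
  have w_len: "n \<le> length (w c n)" for c n
    using \<sigma>(1)[of n] path_lev unfolding P_def w_def by blast
  have w_dec: "cyl (w c (Suc n)) \<subseteq> cyl (w c n)" for c n
    using \<sigma>(2)[of n] path_lev unfolding Q_def w_def path_Suc by blast
  have w_dec': "cyl (w c m) \<subseteq> cyl (w c n)" if "n \<le> m" for c n m
    using lift_Suc_antimono_le[of "\<lambda>n. cyl (w c n)"] w_dec that by blast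
  have w_common: "\<exists>x. \<forall>c. pts G (w c n) x \<noteq> {}" for n
    using \<sigma>(1)[of n] path_lev unfolding P_def compat_def w_def by blast
  have "\<exists>a. \<forall>n. a \<in> cyl (w c n)" for c
    using cyl_chain_limit[of "w c"] w_dec w_len by blast
  then obtain a where a: "\<And>c n. a c \<in> cyl (w c n)" by metis
  have "C \<inter> cyl (w c n) \<noteq> {}" for c n
    using w_common[of n] unfolding pts_def by blast
  then have aC: "a c \<in> C" for c
    using cyl_chain_closed[of "a c" "w c" C] a w_len C(1) by blast
  \<comment> \<open>At a late common level, both branches have parameters over one point
    \<open>x\<close>, which would have to lie in both of two disjoint neighbourhoods.\<close>
  have same: "fst (\<phi> (a c)) = fst (\<phi> (a d))" for c d
  proof (rule ccontr)
    assume "fst (\<phi> (a c)) \<noteq> fst (\<phi> (a d))"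
    then obtain U V where UV: "open U" "open V" "fst (\<phi> (a c)) \<in> U" "fst (\<phi> (a d)) \<in> V" "U \<inter> V = {}"
      by (meson hausdorff)
    obtain n where n: "(fst \<circ> \<phi>) ` (C \<inter> cyl (w c n)) \<subseteq> U"
      using cyl_chain_continuous[OF a[of c] w_len[of _ c] cont(2) aC[of c] UV(1)] UV(3) by auto
    obtain m where m: "(fst \<circ> \<phi>) ` (C \<inter> cyl (w d m)) \<subseteq> V"
      using cyl_chain_continuous[OF a[of d] w_len[of _ d] cont(2) aC[of d] UV(2)] UV(4) by auto
    obtain x where x: "\<And>e. pts G (w e (max n m)) x \<noteq> {}" using w_common by blast
    have "x \<in> U"
      using x[of c] n w_dec'[of n "max n m" c] unfolding pts_def by auto
    moreover have "x \<in> V"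
      using x[of d] m w_dec'[of m "max n m" d] unfolding pts_def by auto
    ultimately show False using UV(5) by blast
  qed
  have "inj (\<lambda>c. snd (\<phi> (a c)))"
  proof (rule injI, rule ccontr)
    fix c d assume eq: "snd (\<phi> (a c)) = snd (\<phi> (a d))" and "c \<noteq> d"
    then have "\<exists>n. c n \<noteq> d n" by auto
    \<comment> \<open>Up to the first difference both branches pass through the same nodes; they
      then enter two halves whose values are disjoint.\<close>
    define n where "n = (LEAST n. c n \<noteq> d n)"
    have n: "c n \<noteq> d n" unfolding n_def using \<open>\<exists>n. c n \<noteq> d n\<close> by (rule LeastI_ex)
    have "c i = d i" if "i < n" for i using not_less_Least that unfolding n_def by blast
    then have "path c n = path d n" by (simp add: path_def)
    then have *: "w c (Suc n) = \<sigma> (Suc n) (c n # path c n)" "w d (Suc n) = \<sigma> (Suc n) (d n # path c n)"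
      by (simp_all add: w_def path_Suc)
    have "(snd \<circ> \<phi>) ` (C \<inter> cyl (w c (Suc n))) \<inter> (snd \<circ> \<phi>) ` (C \<inter> cyl (w d (Suc n))) = {}"
    proof -
      define J where "J v = (snd \<circ> \<phi>) ` (C \<inter> cyl (\<sigma> (Suc n) (v # path c n)))" for v
      have "J True \<inter> J False = {}"
        using \<sigma>(2)[of n] path_lev[of c n] unfolding Q_def J_def by blast
      then have "J (c n) \<inter> J (d n) = {}"
        using n by (cases "c n"; cases "d n") (simp_all add: Int_commute)
      then show ?thesis unfolding J_def * .
    qed
    moreover have "(snd \<circ> \<phi>) (a c) \<in> (snd \<circ> \<phi>) ` (C \<inter> cyl (w c (Suc n)))"
      "(snd \<circ> \<phi>) (a d) \<in> (snd \<circ> \<phi>) ` (C \<inter> cyl (w d (Suc n)))"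
      using a aC by blast+
    ultimately show False using eq by auto
  qed
  moreover have "range (\<lambda>c. snd (\<phi> (a c))) \<subseteq> R `` {fst (\<phi> (a (\<lambda>_. True)))}"
    using aC same C(3) by (auto simp: Image_singleton_iff) (metis image_eqI prod.collapse)
  ultimately have "countable (UNIV :: (nat \<Rightarrow> bool) set)"
    using countable_sections countable_subset countable_image_inj_on by blast
  then obtain e :: "(nat \<Rightarrow> bool) \<Rightarrow> nat" where "inj e" by (auto simp: countable_def)
  \<comment> \<open>Cantor's diagonal sequence against the sequences coded by
    \<open>e\<close>.\<close>
  define D where "D n \<longleftrightarrow> \<not> inv e n n" for n
  have "D (e D) \<longleftrightarrow> \<not> inv e (e D) (e D)" by (rule D_def)
  then show False unfolding inv_f_f[OF \<open>inj e\<close>] by blast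
qed

section \<open>Coding standard Borel spaces by sequences\<close>

text \<open>With a dense sequence \<open>D\<close>, a point is coded by the indices of its least \<open>2\<^sup>-\<^sup>n\<close>-approximations;
  completeness decodes every sequence of indices that is Cauchy at this rate.\<close>

lemma standard_borel_coding:
  fixes Y :: "'a measure"
  assumes "standard_borel Y" and ne: "space Y \<noteq> {}"
  shows "\<exists>e g. e \<in> Y \<rightarrow>\<^sub>M (borel :: (nat \<Rightarrow> nat) measure) \<and> g \<in> borel \<rightarrow>\<^sub>M Y \<and> (\<forall>y\<in>space Y. g (e y) = y)"
proof -
  obtain X where X: "separable_space X" "completely_metrizable_space X" "topspace X = space Y"
      "sets Y = sigma_sets (topspace X) {U. openin X U}"
    using assms(1) unfolding standard_borel_def by blast
  obtain M d where M: "Metric_space M d" "Metric_space.mcomplete M d" "X = Metric_space.mtopology M d"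
    using X(2) unfolding completely_metrizable_space_def by blast
  interpret Metric_space M d by (rule M(1))
  have sp: "space Y = M" using X(3) M(3) by simp
  obtain S where S: "countable S" "S \<subseteq> M" "mtopology closure_of S = M"
    using X(1) M(3) unfolding separable_space_def by auto
  have "S \<noteq> {}" using S(3) ne sp by auto
  define D where "D = from_nat_into S"
  have D: "D n \<in> M" for n
    using from_nat_into[OF \<open>S \<noteq> {}\<close>, of n] S(2) unfolding D_def by blast
  have dense: "\<exists>j. d y (D j) < r" if y: "y \<in> M" and r: "r > 0" for y r
  proof -
    have "y \<in> mtopology closure_of S" using S(3) y by simp
    then obtain s where "s \<in> S" "s \<in> mball y r" using r unfolding metric_closure_of by blast
    then show ?thesis using from_nat_into_surj[OF S(1)] unfolding D_def by (metis in_mball)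
  qed
  define h where "h n = (1 / 2 :: real) ^ n" for n :: nat
  have h: "h n > 0" for n by (simp add: h_def)
  have h_small: "\<exists>n. h n < r" if "r > 0" for r
    unfolding h_def using real_arch_pow_inv[of r "1/2"] that by auto
  have h_mono: "h m \<le> h n" if "n \<le> m" for m n
    unfolding h_def using that by (intro power_decreasing) auto
  have openY: "U \<in> sets Y" if "openin mtopology U" for U
    using that X(4) M(3) by (auto intro: sigma_sets.Basic)

  define e where "e y n = (LEAST j. d y (D j) < h n)" for y n
  have e_meas: "e \<in> Y \<rightarrow>\<^sub>M borel"
    unfolding measurable_Baire_iff
  proof
    fix n
    have "Measurable.pred Y (\<lambda>y. d y (D j) < h n)" for j
    proof -
      have "{y \<in> space Y. d y (D j) < h n} = mball (D j) (h n)"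
        unfolding sp using D by (auto simp: commute)
      then show ?thesis unfolding pred_def using openY by simp
    qed
    then show "(\<lambda>y. e y n) \<in> Y \<rightarrow>\<^sub>M count_space UNIV"
      unfolding e_def by (rule measurable_Least)
  qed
  have e: "d y (D (e y n)) < h n" if "y \<in> M" for y n
    unfolding e_def using dense[OF that h[of n]] by (rule LeastI_ex)

  \<comment> \<open>The bound is what the triangle inequality gives for approximations of a single
    point, and it forces the Cauchy property.\<close>
  define K where "K = {v. \<forall>n m. d (D (v n)) (D (v m)) \<le> h n + h m}"
  \<comment> \<open>The inequality is not strict, because only such a bound survives the passage to
    the limit.\<close>
  define lim where "lim v y \<longleftrightarrow> y \<in> M \<and> (\<forall>n. d y (D (v n)) \<le> h n)" for v y
  have lim_unique: "y = y'" if "lim v y" "lim v y'" for v y y'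
  proof (rule ccontr)
    assume "y \<noteq> y'"
    then have "d y y' > 0" using that by (simp add: lim_def)
    then obtain n where "h n < d y y' / 2" using h_small[of "d y y' / 2"] by auto
    moreover have "d y y' \<le> d y (D (v n)) + d y' (D (v n))"
      using triangle''[of y "D (v n)" y'] that D by (simp add: lim_def commute)
    ultimately show False using that unfolding lim_def by (smt (verit) field_sum_of_halves)
  qed
  have lim_ex: "\<exists>y. lim v y" if v: "v \<in> K" for v
  proof -
    have "MCauchy (\<lambda>n. D (v n))"
      unfolding MCauchy_def
    proof (intro conjI allI impI)
      fix r :: real assume "r > 0"
      then obtain N where N: "h N < r / 2" using h_small[of "r / 2"] by auto
      show "\<exists>N. \<forall>n n'. N \<le> n \<longrightarrow> N \<le> n' \<longrightarrow> d (D (v n)) (D (v n')) < r"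
      proof (intro exI[of _ N] allI impI)
        fix n m assume "N \<le> n" "N \<le> m"
        then have "h n \<le> h N" "h m \<le> h N" by (auto intro: h_mono)
        moreover have "d (D (v n)) (D (v m)) \<le> h n + h m" using v unfolding K_def by blast
        ultimately show "d (D (v n)) (D (v m)) < r" using N by linarith
      qed
    qed (use D in auto)
    then obtain y where "limitin mtopology (\<lambda>n. D (v n)) y sequentially"
      using M(2) unfolding mcomplete_def by blast
    then have y: "y \<in> M" "\<And>r. r > 0 \<Longrightarrow> \<exists>N. \<forall>n\<ge>N. d (D (v n)) y < r"
      unfolding limit_metric_sequentially by blast+
    have "d y (D (v n)) \<le> h n" for n
    proof (rule field_le_epsilon)
      fix r :: real assume r: "r > 0"
      obtain N where N: "\<And>m. m \<ge> N \<Longrightarrow> d (D (v m)) y < r / 2" using y(2)[of "r / 2"] r by auto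
      obtain k where k: "h k < r / 2" using h_small[of "r / 2"] r by auto
      define m where "m = max N k"
      have "h m \<le> h k" by (rule h_mono) (simp add: m_def)
      moreover have "d (D (v m)) y < r / 2" by (rule N) (simp add: m_def)
      moreover have "d (D (v n)) (D (v m)) \<le> h n + h m" using v unfolding K_def by blast
      moreover have "d y (D (v n)) \<le> d (D (v m)) y + d (D (v n)) (D (v m))"
        using triangle[of y "D (v m)" "D (v n)"] D y(1) by (simp add: commute)
      ultimately show "d y (D (v n)) \<le> h n + r" using k by linarith
    qed
    then show ?thesis using y(1) unfolding lim_def by blast
  qed
  \<comment> \<open>\<open>D 0\<close> is a default that keeps \<open>g\<close> inside the
    space.\<close>
  define g where "g v = (if v \<in> K then THE y. lim v y else D 0)" for v
  have g_eq: "g v = y" if "v \<in> K" "lim v y" for v y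
    unfolding g_def using that lim_unique by (auto intro!: the_equality)
  have g_lim: "lim v (g v)" if "v \<in> K" for v
    using lim_ex[OF that] g_eq[OF that] by blast
  have g_M: "g v \<in> M" for v
    using g_lim[of v] D[of 0] by (cases "v \<in> K") (auto simp: lim_def g_def)
  have ge: "g (e y) = y" if y: "y \<in> M" for y
  proof (rule g_eq)
    show "lim (e y) y" unfolding lim_def using y e[OF y] by (auto intro: less_imp_le)
    have "d (D (e y n)) (D (e y m)) \<le> h n + h m" for n m
      using triangle[of "D (e y n)" y "D (e y m)"] D y e[OF y, of n] e[OF y, of m]
      by (simp add: commute)
    then show "e y \<in> K" unfolding K_def by blast
  qed
  have coord: "(\<lambda>v. v n) \<in> (borel :: (nat \<Rightarrow> nat) measure) \<rightarrow>\<^sub>M count_space UNIV" for n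
    using measurable_ident_sets[of borel "borel :: (nat \<Rightarrow> nat) measure"] measurable_Baire_iff[of "\<lambda>x. x"]
    by auto
  have coord1: "{v. P (v n)} \<in> sets (borel :: (nat \<Rightarrow> nat) measure)" for P n
    using measurable_sets[OF coord[of n], of "{i. P i}"] by (simp add: vimage_def)
  have K_meas: "K \<in> sets borel"
  proof -
    have "K = (\<Inter>n. \<Inter>m. \<Union>i. \<Union>j. if d (D i) (D j) \<le> h n + h m then {v. v n = i} \<inter> {v. v m = j} else {})"
      unfolding K_def by auto
    also have "\<dots> \<in> sets borel"
      by (intro sets.countable_INT'' sets.countable_UN' sets.countable_INT' ) (auto intro!: sets.countable_UN coord1 sets.Int)
    finally show ?thesis .
  qed
  have "g \<in> borel \<rightarrow>\<^sub>M Y"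
  proof (rule measurable_sigma_sets)
    show "sets Y = sigma_sets M {U. openin mtopology U}" using X(4) M(3) by simp
    show "{U. openin mtopology U} \<subseteq> Pow M" using openin_subset by fastforce
    show "g \<in> space borel \<rightarrow> M" using g_M by auto
    fix U assume "U \<in> {U. openin mtopology U}"
    then have U: "openin mtopology U" by simp
    \<comment> \<open>The closed balls contain \<open>g v\<close> and their radii tend to zero.
      Membership in \<open>U\<close> thus becomes a countable disjunction of conditions on single
      coordinates.\<close>
    have *: "g v \<in> U \<longleftrightarrow> (\<exists>n. mcball (D (v n)) (h n) \<subseteq> U)" if v: "v \<in> K" for v
    proof
      assume "g v \<in> U"
      then obtain r where r: "r > 0" "mball (g v) r \<subseteq> U" using U unfolding openin_mtopology by blast
      then obtain n where n: "h n < r / 2" using h_small[of "r / 2"] by auto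
      have "mcball (D (v n)) (h n) \<subseteq> mball (g v) r"
      proof
        fix z assume "z \<in> mcball (D (v n)) (h n)"
        then have z: "z \<in> M" "d (D (v n)) z \<le> h n" by auto
        have "d (g v) (D (v n)) \<le> h n" using g_lim[OF v] unfolding lim_def by blast
        then have "d (g v) z < r" using triangle[of "g v" "D (v n)" z] g_M D z n by fastforce
        then show "z \<in> mball (g v) r" using z g_M by simp
      qed
      then show "\<exists>n. mcball (D (v n)) (h n) \<subseteq> U" using r by blast
    next
      assume "\<exists>n. mcball (D (v n)) (h n) \<subseteq> U"
      then obtain n where n: "mcball (D (v n)) (h n) \<subseteq> U" by blast
      have "g v \<in> mcball (D (v n)) (h n)" using g_lim[OF v] D g_M by (auto simp: lim_def commute)
      then show "g v \<in> U" using n by blast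
    qed
    have "g -` U \<inter> space borel = (K \<inter> (\<Union>n. {v. mcball (D (v n)) (h n) \<subseteq> U})) \<union> (if D 0 \<in> U then - K else {})"
    proof (rule set_eqI)
      fix v
      show "v \<in> g -` U \<inter> space borel \<longleftrightarrow>
          v \<in> (K \<inter> (\<Union>n. {v. mcball (D (v n)) (h n) \<subseteq> U})) \<union> (if D 0 \<in> U then - K else {})"
        by (cases "v \<in> K") (simp_all add: *, simp add: g_def)
    qed
    also have "\<dots> \<in> sets borel"
      using K_meas coord1[of "\<lambda>i. mcball (D i) (h _) \<subseteq> U"]
      by (intro sets.Un sets.Int sets.countable_UN) (auto intro: coord1 borel_comp)
    finally show "g -` U \<inter> space borel \<in> sets borel" .
  qed
  then show ?thesis using e_meas ge sp by blast
qed

text \<open>Coding is injective because it can be undone, so equality reduces to countably many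
  equalities of naturals.\<close>

lemma standard_borel_eq_sets:
  assumes "standard_borel Z" "f \<in> M \<rightarrow>\<^sub>M Z" "g \<in> M \<rightarrow>\<^sub>M Z"
  shows "{x \<in> space M. f x = g x} \<in> sets M"
proof (cases "space Z = {}")
  case True
  then have "space M = {}" using measurable_space[OF assms(2)] by auto
  then show ?thesis by simp
next
  case False
  obtain e and k :: "(nat \<Rightarrow> nat) \<Rightarrow> _" where e: "e \<in> Z \<rightarrow>\<^sub>M (borel :: (nat \<Rightarrow> nat) measure)" "\<And>z. z \<in> space Z \<Longrightarrow> k (e z) = z"
    using standard_borel_coding[OF assms(1) False] by blast
  have "{x \<in> space M. e (f x) n = e (g x) n} \<in> sets M" for n
  proof -
    have m: "(\<lambda>x. e (f x) n) \<in> M \<rightarrow>\<^sub>M count_space UNIV" "(\<lambda>x. e (g x) n) \<in> M \<rightarrow>\<^sub>M count_space UNIV"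
      using measurable_compose[OF assms(2) e(1)] measurable_compose[OF assms(3) e(1)]
      unfolding measurable_Baire_iff by auto
    have "{x \<in> space M. e (f x) n = e (g x) n} =
        (\<Union>i. ((\<lambda>x. e (f x) n) -` {i} \<inter> space M) \<inter> ((\<lambda>x. e (g x) n) -` {i} \<inter> space M))"
      by auto
    also have "\<dots> \<in> sets M"
      using measurable_sets[OF m(1)] measurable_sets[OF m(2)] by (intro sets.countable_UN' sets.Int) auto
    finally show ?thesis .
  qed
  then have "{x \<in> space M. \<forall>n. e (f x) n = e (g x) n} \<in> sets M"
    by (rule sets.sets_Collect_countable_All)
  also have "{x \<in> space M. \<forall>n. e (f x) n = e (g x) n} = {x \<in> space M. f x = g x}"
    using e(2) measurable_space[OF assms(2)] measurable_space[OF assms(3)] by (auto simp: fun_eq_iff[symmetric]) (metis)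
  finally show ?thesis .
qed

text \<open>The cover on Baire space is transported along codes: encode \<open>y\<close>, apply a
  function of the cover, decode.\<close>

theorem lusin_novikov:
  fixes Y :: "'a measure" and Z :: "'b measure"
  assumes "standard_borel Y" "standard_borel Z" and H: "H \<in> sets (Y \<Otimes>\<^sub>M Z)" "H \<noteq> {}"
    and countable_sections: "\<And>y. y \<in> space Y \<Longrightarrow> countable {z \<in> space Z. (y, z) \<in> H}"
  shows "\<exists>f :: nat \<Rightarrow> 'a \<Rightarrow> 'b. (\<forall>n. f n \<in> Y \<rightarrow>\<^sub>M Z) \<and> (\<forall>y z. (y, z) \<in> H \<longrightarrow> (\<exists>n. z = f n y))"
proof -
  have HYZ: "H \<subseteq> space Y \<times> space Z" using sets.sets_into_space[OF H(1)] by (simp add: space_pair_measure)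
  then have "space Y \<noteq> {}" "space Z \<noteq> {}" using H(2) by auto
  then obtain eY gY eZ gZ where
    Y: "eY \<in> Y \<rightarrow>\<^sub>M (borel :: (nat \<Rightarrow> nat) measure)" "gY \<in> borel \<rightarrow>\<^sub>M Y" "\<And>y. y \<in> space Y \<Longrightarrow> gY (eY y) = y" and
    Z: "eZ \<in> Z \<rightarrow>\<^sub>M (borel :: (nat \<Rightarrow> nat) measure)" "gZ \<in> borel \<rightarrow>\<^sub>M Z" "\<And>z. z \<in> space Z \<Longrightarrow> gZ (eZ z) = z"
    using standard_borel_coding assms(1,2) by metis
  note [measurable] = Y(1,2) Z(1,2)
  define m where "m p = (gY (fst p), gZ (snd p))" for p
  have m: "m \<in> borel \<rightarrow>\<^sub>M (Y \<Otimes>\<^sub>M Z)"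
    unfolding m_def borel_prod[symmetric] by measurable
  define q where "q p = (snd p, snd p)" for p :: "(nat \<Rightarrow> nat) \<times> (nat \<Rightarrow> nat)"
  have q: "q \<in> borel \<rightarrow>\<^sub>M borel"
    unfolding q_def borel_prod[symmetric] by measurable
  \<comment> \<open>The second condition keeps only the canonical code of each \<open>z\<close>. A
    point may have uncountably many codes, which would spoil the countability of sections.\<close>
  define R where "R = m -` H \<inter> q -` graphs {eZ \<circ> gZ}"
  have "graphs {eZ \<circ> gZ} \<in> sets borel"
    using Z(1,2) by (intro graphs_borel) auto
  then have "R \<in> sets borel"
    unfolding R_def using measurable_sets[OF m H(1)] measurable_sets[OF q] by auto
  then have "analytic_set R" using bianalytic_borel_Baire_prod bianalytic_def by blast
  have "countable (R `` {u})" for u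
  proof (rule countable_subset)
    show "R `` {u} \<subseteq> eZ ` {z \<in> space Z. (gY u, z) \<in> H}"
    proof
      fix v assume "v \<in> R `` {u}"
      then have "(gY u, gZ v) \<in> H" "v = eZ (gZ v)" by (auto simp: R_def m_def q_def graphs_def)
      moreover have "gZ v \<in> space Z" using measurable_space[OF Z(2)] by simp
      ultimately show "v \<in> eZ ` {z \<in> space Z. (gY u, z) \<in> H}" by blast
    qed
    show "countable (eZ ` {z \<in> space Z. (gY u, z) \<in> H})"
      using measurable_space[OF Y(2), of u] by (intro countable_image countable_sections) auto
  qed
  from lusin_novikov_cover[OF \<open>analytic_set R\<close> this]
  obtain F where F: "countable F" "F \<subseteq> borel_measurable borel" "R \<subseteq> graphs F"
    by blast
  \<comment> \<open>The identity is inserted so that there is something to enumerate even when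
    \<open>F\<close> is empty.\<close>
  define f where "f = from_nat_into (insert (\<lambda>x. x) F)"
  have f: "f n \<in> borel_measurable borel" for n
    using from_nat_into[of "insert (\<lambda>x. x) F" n] F(2) unfolding f_def by auto
  have "\<exists>n. z = (gZ \<circ> f n \<circ> eY) y" if yz: "(y, z) \<in> H" for y z
  proof -
    have s: "y \<in> space Y" "z \<in> space Z" using yz HYZ by auto
    then have "(eY y, eZ z) \<in> R"
      using yz Y(3) Z(3) by (simp add: R_def m_def q_def graphs_def)
    then obtain k where "k \<in> F" "eZ z = k (eY y)" using F(3) unfolding graphs_def by blast
    moreover from this obtain n where "k = f n"
      using from_nat_into_surj[of "insert (\<lambda>x. x) F" k] F(1) unfolding f_def by auto
    ultimately show ?thesis using Z(3)[OF s(2)] by (intro exI[of _ n]) simp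
  qed
  moreover have "gZ \<circ> f n \<circ> eY \<in> Y \<rightarrow>\<^sub>M Z" for n
    using f Y(1) Z(2) by (intro measurable_comp)
  ultimately show ?thesis by (intro exI[of _ "\<lambda>n. gZ \<circ> f n \<circ> eY"]) blast
qed

section \<open>Greedy matchings\<close>

text \<open>\<open>A\<close> and \<open>B\<close> are the vertices already in use. Allowing all
  Borel ones lets stages be chained, provided the newly used vertices are Borel too; this is
  demanded because projections of Borel sets need not be Borel.\<close>

definition greedy_matchable :: "'a measure \<Rightarrow> 'b measure \<Rightarrow> ('a \<times> 'b) set \<Rightarrow> bool" where
  "greedy_matchable Y Z G \<longleftrightarrow> (\<forall>A\<in>sets Y. \<forall>B\<in>sets Z. \<exists>M.
     M \<in> sets (Y \<Otimes>\<^sub>M Z) \<and> M \<subseteq> G \<and> single_valued M \<and> single_valued (M\<inverse>) \<and>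
     Domain M \<in> sets Y \<and> Range M \<in> sets Z \<and> Domain M \<inter> A = {} \<and> Range M \<inter> B = {} \<and>
     (\<forall>y z. (y, z) \<in> G \<longrightarrow> y \<in> A \<union> Domain M \<or> z \<in> B \<union> Range M))"

lemma measurable_graph_part:
  assumes "standard_borel Z" "f \<in> Y \<rightarrow>\<^sub>M Z" "H \<in> sets (Y \<Otimes>\<^sub>M Z)"
  shows "{p \<in> H. snd p = f (fst p)} \<in> sets (Y \<Otimes>\<^sub>M Z)"
proof -
  have "{p \<in> space (Y \<Otimes>\<^sub>M Z). snd p = f (fst p)} \<in> sets (Y \<Otimes>\<^sub>M Z)"
    by (rule standard_borel_eq_sets[OF assms(1) measurable_snd measurable_compose[OF measurable_fst assms(2)]])
  then have "H \<inter> {p \<in> space (Y \<Otimes>\<^sub>M Z). snd p = f (fst p)} \<in> sets (Y \<Otimes>\<^sub>M Z)"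
    using assms(3) by blast
  also have "H \<inter> {p \<in> space (Y \<Otimes>\<^sub>M Z). snd p = f (fst p)} = {p \<in> H. snd p = f (fst p)}"
    using sets.sets_into_space[OF assms(3)] by auto
  finally show ?thesis .
qed

lemma measurable_inverse_graph_part:
  assumes "standard_borel Y" "h \<in> Z \<rightarrow>\<^sub>M Y" "H \<in> sets (Y \<Otimes>\<^sub>M Z)"
  shows "{p \<in> H. fst p = h (snd p)} \<in> sets (Y \<Otimes>\<^sub>M Z)"
proof -
  have "{p \<in> space (Y \<Otimes>\<^sub>M Z). fst p = h (snd p)} \<in> sets (Y \<Otimes>\<^sub>M Z)"
    by (rule standard_borel_eq_sets[OF assms(1) measurable_fst measurable_compose[OF measurable_snd assms(2)]])
  then have "H \<inter> {p \<in> space (Y \<Otimes>\<^sub>M Z). fst p = h (snd p)} \<in> sets (Y \<Otimes>\<^sub>M Z)"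
    using assms(3) by blast
  also have "H \<inter> {p \<in> space (Y \<Otimes>\<^sub>M Z). fst p = h (snd p)} = {p \<in> H. fst p = h (snd p)}"
    using sets.sets_into_space[OF assms(3)] by auto
  finally show ?thesis .
qed

text \<open>No two edges of \<open>G\<close> share an end, so all edges with both ends free can be
  taken at once. Domain and range are preimages of \<open>M\<close> under the two graph maps, hence
  measurable.\<close>

lemma greedy_matchable_partial_injection:
  assumes "G \<in> sets (Y \<Otimes>\<^sub>M Z)" "f \<in> Y \<rightarrow>\<^sub>M Z" "h \<in> Z \<rightarrow>\<^sub>M Y"
    and G: "\<And>y z. (y, z) \<in> G \<Longrightarrow> z = f y \<and> y = h z"
  shows "greedy_matchable Y Z G"
  unfolding greedy_matchable_def
proof (intro ballI)
  fix A B assume AB: "A \<in> sets Y" "B \<in> sets Z"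
  define M where "M = G - A \<times> space Z - space Y \<times> B"
  have M: "M \<in> sets (Y \<Otimes>\<^sub>M Z)" unfolding M_def using assms(1) AB by auto
  have sub: "M \<subseteq> space Y \<times> space Z" using sets.sets_into_space[OF M] by (simp add: space_pair_measure)
  have "M \<subseteq> G" by (auto simp: M_def)
  have fm: "(\<lambda>y. (y, f y)) \<in> Y \<rightarrow>\<^sub>M (Y \<Otimes>\<^sub>M Z)" and hm: "(\<lambda>z. (h z, z)) \<in> Z \<rightarrow>\<^sub>M (Y \<Otimes>\<^sub>M Z)"
    using assms(2,3) by auto
  have "Domain M = (\<lambda>y. (y, f y)) -` M \<inter> space Y"
    using sub G \<open>M \<subseteq> G\<close> by (auto simp: Domain_unfold)
  moreover have "Range M = (\<lambda>z. (h z, z)) -` M \<inter> space Z"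
    using sub G \<open>M \<subseteq> G\<close> by (auto simp: Range_iff)
  ultimately have "Domain M \<in> sets Y" "Range M \<in> sets Z"
    using measurable_sets[OF fm M] measurable_sets[OF hm M] by simp_all
  moreover have "single_valued M" "single_valued (M\<inverse>)"
    using G \<open>M \<subseteq> G\<close> unfolding single_valued_def by blast+
  moreover have "Domain M \<inter> A = {}" "Range M \<inter> B = {}"
    using sub unfolding M_def by auto
  moreover have "y \<in> A \<union> Domain M \<or> z \<in> B \<union> Range M" if "(y, z) \<in> G" for y z
    using that unfolding M_def by auto
  ultimately show "\<exists>M. M \<in> sets (Y \<Otimes>\<^sub>M Z) \<and> M \<subseteq> G \<and> single_valued M \<and> single_valued (M\<inverse>) \<and>
     Domain M \<in> sets Y \<and> Range M \<in> sets Z \<and> Domain M \<inter> A = {} \<and> Range M \<inter> B = {} \<and>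
     (\<forall>y z. (y, z) \<in> G \<longrightarrow> y \<in> A \<union> Domain M \<or> z \<in> B \<union> Range M)"
    using M \<open>M \<subseteq> G\<close> by blast
qed

text \<open>Stage \<open>k\<close> treats everything used earlier as occupied. The unions up to
  \<open>k\<close> in the last clause record maximality at that stage; the length estimate needs
  this, and the total union would lose it.\<close>

lemma greedy_matchable_sequence:
  assumes G: "\<And>k. greedy_matchable Y Z (G k)" and AB: "A \<in> sets Y" "B \<in> sets Z"
  obtains M :: "nat \<Rightarrow> ('a \<times> 'b) set" where
    "\<And>k. M k \<in> sets (Y \<Otimes>\<^sub>M Z)" "\<And>k. M k \<subseteq> G k"
    "\<And>k. Domain (M k) \<in> sets Y" "\<And>k. Range (M k) \<in> sets Z"
    "\<And>k. Domain (M k) \<inter> A = {}" "\<And>k. Range (M k) \<inter> B = {}"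
    "single_valued (\<Union>k. M k)" "single_valued ((\<Union>k. M k)\<inverse>)"
    "\<And>j k. j < k \<Longrightarrow> Domain (M j) \<inter> Domain (M k) = {}"
    "\<And>k y z. (y, z) \<in> G k \<Longrightarrow>
        y \<in> A \<union> (\<Union>j\<le>k. Domain (M j)) \<or> z \<in> B \<union> (\<Union>j\<le>k. Range (M j))"
proof -
  define good where "good k A B M \<longleftrightarrow> M \<in> sets (Y \<Otimes>\<^sub>M Z) \<and> M \<subseteq> G k \<and> single_valued M \<and>
     single_valued (M\<inverse>) \<and> Domain M \<in> sets Y \<and> Range M \<in> sets Z \<and> Domain M \<inter> A = {} \<and> Range M \<inter> B = {} \<and>
     (\<forall>y z. (y, z) \<in> G k \<longrightarrow> y \<in> A \<union> Domain M \<or> z \<in> B \<union> Range M)" for k A B M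
  define m where "m k A B = (SOME M. good k A B M)" for k A B
  have m: "good k A B (m k A B)" if "A \<in> sets Y" "B \<in> sets Z" for k A B
  proof -
    have "\<exists>M. good k A B M"
      using bspec[OF bspec[OF G[of k, unfolded greedy_matchable_def] that(1)] that(2)]
      unfolding good_def .
    then show ?thesis unfolding m_def by (rule someI_ex)
  qed
  \<comment> \<open>\<open>S k\<close> holds the vertices occupied before stage
    \<open>k\<close>.\<close>
  define S where "S = rec_nat (A, B) (\<lambda>k (A, B). (A \<union> Domain (m k A B), B \<union> Range (m k A B)))"
  define M where "M k = m k (fst (S k)) (snd (S k))" for k
  have S0: "S 0 = (A, B)" by (simp add: S_def)
  have SS: "S (Suc k) = (fst (S k) \<union> Domain (M k), snd (S k) \<union> Range (M k))" for k
    by (simp add: S_def M_def split_beta)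
  have S_sets: "fst (S k) \<in> sets Y \<and> snd (S k) \<in> sets Z" for k
  proof (induction k)
    case (Suc k)
    then have "good k (fst (S k)) (snd (S k)) (M k)" unfolding M_def by (intro m) auto
    then show ?case using Suc unfolding good_def SS by auto
  qed (simp add: S0 AB)
  have M: "good k (fst (S k)) (snd (S k)) (M k)" for k
    unfolding M_def using S_sets by (intro m) auto
  have S_eq: "S k = (A \<union> (\<Union>j<k. Domain (M j)), B \<union> (\<Union>j<k. Range (M j)))" for k
    by (induction k) (simp_all add: S0 SS lessThan_Suc Un_ac)
  have new: "Domain (M k) \<inter> (A \<union> (\<Union>j<k. Domain (M j))) = {}"
      "Range (M k) \<inter> (B \<union> (\<Union>j<k. Range (M j))) = {}" for k
    using M[of k] unfolding good_def S_eq fst_conv snd_conv by simp_all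
  have disj: "Domain (M j) \<inter> Domain (M k) = {}" "Range (M j) \<inter> Range (M k) = {}" if "j < k" for j k
    using new[of k] that by blast+
  have disj': "j = k" if "x \<in> Domain (M j)" "x \<in> Domain (M k)" for x j k
    using disj(1)[of j k] disj(1)[of k j] that by (cases j k rule: linorder_cases) auto
  have disj'': "j = k" if "x \<in> Range (M j)" "x \<in> Range (M k)" for x j k
    using disj(2)[of j k] disj(2)[of k j] that by (cases j k rule: linorder_cases) auto
  have "single_valued (\<Union>k. M k)"
  proof (rule single_valuedI)
    fix x y z assume "(x, y) \<in> (\<Union>k. M k)" "(x, z) \<in> (\<Union>k. M k)"
    then obtain j k where "(x, y) \<in> M j" "(x, z) \<in> M k" by blast
    moreover from this have "j = k" by (intro disj') auto
    ultimately show "y = z" using M[of k] unfolding good_def by (auto dest: single_valuedD)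
  qed
  moreover have "single_valued ((\<Union>k. M k)\<inverse>)"
  proof (rule single_valuedI)
    fix x y z assume "(x, y) \<in> (\<Union>k. M k)\<inverse>" "(x, z) \<in> (\<Union>k. M k)\<inverse>"
    then obtain j k where "(x, y) \<in> (M j)\<inverse>" "(x, z) \<in> (M k)\<inverse>" by blast
    moreover from this have "j = k" by (intro disj'') auto
    ultimately show "y = z" using M[of k] unfolding good_def by (auto dest: single_valuedD)
  qed
  moreover have "M k \<in> sets (Y \<Otimes>\<^sub>M Z)" "M k \<subseteq> G k" "Domain (M k) \<in> sets Y" "Range (M k) \<in> sets Z" for k
    using M[of k] unfolding good_def by simp_all
  moreover have "Domain (M k) \<inter> A = {}" "Range (M k) \<inter> B = {}" for k
    using new[of k] by blast+
  moreover have "y \<in> A \<union> (\<Union>j\<le>k. Domain (M j)) \<or> z \<in> B \<union> (\<Union>j\<le>k. Range (M j))"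
    if "(y, z) \<in> G k" for k y z
  proof -
    have "y \<in> fst (S k) \<union> Domain (M k) \<or> z \<in> snd (S k) \<union> Range (M k)"
      using M[of k] that unfolding good_def by blast
    then have "y \<in> fst (S (Suc k)) \<or> z \<in> snd (S (Suc k))" by (simp add: SS)
    then show ?thesis unfolding S_eq by (simp add: lessThan_Suc_atMost)
  qed
  ultimately show thesis using disj(1) by (intro that[of M])
qed

lemma greedy_matchable_UN:
  assumes "\<And>k :: nat. greedy_matchable Y Z (G k)"
  shows "greedy_matchable Y Z (\<Union>k. G k)"
  unfolding greedy_matchable_def
proof (intro ballI)
  fix A B assume AB: "A \<in> sets Y" "B \<in> sets Z"
  obtain M where M: "\<And>k. M k \<in> sets (Y \<Otimes>\<^sub>M Z)" "\<And>k. M k \<subseteq> G k"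
      "\<And>k. Domain (M k) \<in> sets Y" "\<And>k. Range (M k) \<in> sets Z"
      "\<And>k. Domain (M k) \<inter> A = {}" "\<And>k. Range (M k) \<inter> B = {}"
      "single_valued (\<Union>k. M k)" "single_valued ((\<Union>k. M k)\<inverse>)" 
    and max: "\<And>k y z. (y, z) \<in> G k \<Longrightarrow>
        y \<in> A \<union> (\<Union>j\<le>k. Domain (M j)) \<or> z \<in> B \<union> (\<Union>j\<le>k. Range (M j))"
    by (rule greedy_matchable_sequence[OF assms AB]) (rule that)
  show "\<exists>M. M \<in> sets (Y \<Otimes>\<^sub>M Z) \<and> M \<subseteq> (\<Union>k. G k) \<and> single_valued M \<and> single_valued (M\<inverse>) \<and>
     Domain M \<in> sets Y \<and> Range M \<in> sets Z \<and> Domain M \<inter> A = {} \<and> Range M \<inter> B = {} \<and>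
     (\<forall>y z. (y, z) \<in> (\<Union>k. G k) \<longrightarrow> y \<in> A \<union> Domain M \<or> z \<in> B \<union> Range M)"
  proof (intro exI[of _ "\<Union>k. M k"] conjI allI impI)
    show "(\<Union>k. M k) \<in> sets (Y \<Otimes>\<^sub>M Z)" using M(1) by (intro sets.countable_UN) auto
    have "Domain (\<Union>k. M k) = (\<Union>k. Domain (M k))" "Range (\<Union>k. M k) = (\<Union>k. Range (M k))" by auto
    then show "Domain (\<Union>k. M k) \<in> sets Y" "Range (\<Union>k. M k) \<in> sets Z"
      using M(3,4) by (simp_all add: sets.countable_UN)
    show "Domain (\<Union>k. M k) \<inter> A = {}" "Range (\<Union>k. M k) \<inter> B = {}" "(\<Union>k. M k) \<subseteq> (\<Union>k. G k)"
      using M(2,5,6) by blast+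
    show "y \<in> A \<union> Domain (\<Union>k. M k) \<or> z \<in> B \<union> Range (\<Union>k. M k)" if "(y, z) \<in> (\<Union>k. G k)" for y z
    proof -
      obtain k where "(y, z) \<in> G k" using \<open>(y, z) \<in> (\<Union>k. G k)\<close> by blast
      from max[OF this] show ?thesis by blast
    qed
  qed (fact M(7,8))+
qed

theorem greedy_matchable_locally_countable:
  assumes "standard_borel Y" "standard_borel Z" "G \<in> sets (Y \<Otimes>\<^sub>M Z)"
    and sec: "\<And>y. y \<in> space Y \<Longrightarrow> countable {z \<in> space Z. (y, z) \<in> G}"
      "\<And>z. z \<in> space Z \<Longrightarrow> countable {y \<in> space Y. (y, z) \<in> G}"
  shows "greedy_matchable Y Z G"
proof (cases "G = {}")
  \<comment> \<open>Treated apart because \<open>lusin_novikov\<close> supplies total functions,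
    whose target must have a point.\<close>
  case True
  then show ?thesis unfolding greedy_matchable_def by (intro ballI exI[of _ "{}"]) auto
next
  case False
  obtain f :: "nat \<Rightarrow> _" where f: "\<And>n. f n \<in> Y \<rightarrow>\<^sub>M Z" "\<And>y z. (y, z) \<in> G \<Longrightarrow> \<exists>n. z = f n y"
    using lusin_novikov[OF assms(1-3) False sec(1)] by blast
  have sub: "G \<subseteq> space Y \<times> space Z" using sets.sets_into_space[OF assms(3)] by (simp add: space_pair_measure)
  define G' where "G' = (\<lambda>p. (snd p, fst p)) -` G \<inter> space (Z \<Otimes>\<^sub>M Y)"
  have mem: "(z, y) \<in> G' \<longleftrightarrow> (y, z) \<in> G" for y z
    using sub by (auto simp: G'_def space_pair_measure)
  have "G' \<in> sets (Z \<Otimes>\<^sub>M Y)" unfolding G'_def using assms(3) by (rule measurable_sets[rotated]) auto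
  moreover have "G' \<noteq> {}" using False mem by auto
  ultimately obtain h :: "nat \<Rightarrow> _" where h: "\<And>n. h n \<in> Z \<rightarrow>\<^sub>M Y" "\<And>y z. (y, z) \<in> G \<Longrightarrow> \<exists>n. y = h n z"
    using lusin_novikov[OF assms(2,1), of G'] sec(2) unfolding mem by blast
  \<comment> \<open>\<open>i\<close> codes a pair of functions, one for each direction; satisfying
    both equations makes the piece a partial injection.\<close>
  define E where "E i = {p \<in> {p \<in> G. snd p = f (fst (prod_decode i)) (fst p)}. fst p = h (snd (prod_decode i)) (snd p)}" for i
  have "greedy_matchable Y Z (E i)" for i
  proof (rule greedy_matchable_partial_injection)
    show "E i \<in> sets (Y \<Otimes>\<^sub>M Z)"
      unfolding E_def by (intro measurable_graph_part measurable_inverse_graph_part assms f h)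
    show "f (fst (prod_decode i)) \<in> Y \<rightarrow>\<^sub>M Z" "h (snd (prod_decode i)) \<in> Z \<rightarrow>\<^sub>M Y" by (rule f h)+
    fix y z assume "(y, z) \<in> E i"
    then have "(y, z) \<in> G \<and> snd (y, z) = f (fst (prod_decode i)) (fst (y, z)) \<and>
        fst (y, z) = h (snd (prod_decode i)) (snd (y, z))"
      unfolding E_def by blast
    then show "z = f (fst (prod_decode i)) y \<and> y = h (snd (prod_decode i)) z"
      unfolding fst_conv snd_conv by blast
  qed
  then have "greedy_matchable Y Z (\<Union>i. E i)" by (rule greedy_matchable_UN)
  also have "(\<Union>i. E i) = G"
  proof (intro equalityI subsetI)
    fix p assume "p \<in> G"
    then obtain n m where "snd p = f n (fst p)" "fst p = h m (snd p)" using f(2) h(2) by (metis prod.collapse)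
    then have "p \<in> E (prod_encode (n, m))"
      using \<open>p \<in> G\<close> unfolding E_def prod_encode_inverse fst_conv snd_conv by blast
    then show "p \<in> (\<Union>i. E i)" by blast
  next
    fix p assume "p \<in> (\<Union>i. E i)"
    then show "p \<in> G" unfolding E_def by blast
  qed
  finally show ?thesis .
qed

section \<open>From relations injective in both directions to the maximal matching with the length
  condition\<close>

lemma maximal_matchingI:
  assumes "H \<subseteq> A \<times> B" "A \<inter> B = {}" "M \<subseteq> H" "single_valued M" "single_valued (M\<inverse>)"
    and max: "\<And>y z. (y, z) \<in> H \<Longrightarrow> y \<in> Domain M \<or> z \<in> Range M"
  shows "maximal_matching H M"
  unfolding maximal_matching_def
proof
  have "vertices_of e \<inter> vertices_of e' = {}" if e: "e \<in> M" "e' \<in> M" "e \<noteq> e'" for e e'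
  proof -
    obtain y z y' z' where [simp]: "e = (y, z)" "e' = (y', z')" by (cases e; cases e') auto
    have "y \<noteq> y'" using e single_valuedD[OF assms(4)] by auto
    moreover have "z \<noteq> z'" using e single_valuedD[OF assms(5)] by auto
    \<comment> \<open>Disjointness of the sides excludes the remaining coincidences, of a left end
      with a right end.\<close>
    moreover have "y \<in> A" "y' \<in> A" "z \<in> B" "z' \<in> B" using e assms(1,3) by auto
    ultimately show ?thesis using assms(2) by (auto simp: vertices_of_def)
  qed
  then show "matching H M" unfolding matching_def using assms(3) by blast
  show "\<not> (\<exists>M'. matching H M' \<and> M \<subset> M')"
  proof
    assume "\<exists>M'. matching H M' \<and> M \<subset> M'"
    then obtain M' y z where M': "matching H M'" "M \<subset> M'" "(y, z) \<in> M'" "(y, z) \<notin> M" by auto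
    then have "(y, z) \<in> H" unfolding matching_def by blast
    then obtain e where e: "e \<in> M" "y = fst e \<or> z = snd e" using max by force
    then have "vertices_of e \<inter> vertices_of (y, z) \<noteq> {}" by (auto simp: vertices_of_def)
    moreover have "e \<in> M'" "e \<noteq> (y, z)" using e M' by auto
    ultimately show False using M'(1,3) unfolding matching_def by blast
  qed
qed

theorem lemma7p12:
  fixes Y Z :: "'a measure"
    and H :: "('a \<times> 'a) set"
    and l :: "'a \<times> 'a \<Rightarrow> real"
  assumes "standard_borel Y" and "standard_borel Z"
    and "space Y \<inter> space Z = {}"
    and "H \<in> sets (Y \<Otimes>\<^sub>M Z)"
    and "locally_countable (space Y) (space Z) H"
    and "l \<in> borel_measurable (restrict_space (Y \<Otimes>\<^sub>M Z) H)"
    and "\<forall>e\<in>H. l e > 0"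
  shows "\<exists>M. M \<in> sets (Y \<Otimes>\<^sub>M Z) \<and> maximal_matching H M \<and>
    (\<forall>(y, z)\<in>M.
       l (y, z) \<ge> 1 \<or>
       ennreal (l (y, z)) \<ge>
         (1 / 2) * sup_unmatched Z H l M y)"
proof -
  \<comment> \<open>These sets increase to \<open>H\<close>, because lengths are positive and the
    thresholds tend to zero.\<close>
  define L where "L k = {e \<in> H. (1 / 2) ^ k \<le> l e}" for k :: nat
  have HYZ: "H \<subseteq> space Y \<times> space Z"
    using sets.sets_into_space[OF assms(4)] by (simp add: space_pair_measure)
  have L_sets: "L k \<in> sets (Y \<Otimes>\<^sub>M Z)" for k
  proof -
    have "l -` {(1 / 2) ^ k..} \<inter> space (restrict_space (Y \<Otimes>\<^sub>M Z) H) \<in> sets (restrict_space (Y \<Otimes>\<^sub>M Z) H)"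
      by (rule measurable_sets[OF assms(6)]) simp
    also have "l -` {(1 / 2) ^ k..} \<inter> space (restrict_space (Y \<Otimes>\<^sub>M Z) H) = L k"
      using HYZ by (auto simp: L_def space_restrict_space space_pair_measure)
    finally show ?thesis
      using assms(4) by (subst (asm) sets_restrict_space_iff) (auto simp: Int_absorb2 sets.sets_into_space)
  qed
  have "greedy_matchable Y Z (L k)" for k
    using assms(5) L_sets unfolding locally_countable_def L_def
    by (intro greedy_matchable_locally_countable assms(1,2)) (auto intro: countable_subset[rotated])
  then obtain M where M: "\<And>k. M k \<in> sets (Y \<Otimes>\<^sub>M Z)" "\<And>k. M k \<subseteq> L k"
      "single_valued (\<Union>k. M k)" "single_valued ((\<Union>k. M k)\<inverse>)" 
    and disj: "\<And>j k. j < k \<Longrightarrow> Domain (M j) \<inter> Domain (M k) = {}"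
    and max: "\<And>k y z. (y, z) \<in> L k \<Longrightarrow>
        y \<in> {} \<union> (\<Union>j\<le>k. Domain (M j)) \<or> z \<in> {} \<union> (\<Union>j\<le>k. Range (M j))"
    by (rule greedy_matchable_sequence[OF _ sets.empty_sets sets.empty_sets]) (rule that)
  have "(\<Union>k. M k) \<in> sets (Y \<Otimes>\<^sub>M Z)" using M(1) by (intro sets.countable_UN) auto
  moreover have "maximal_matching H (\<Union>k. M k)"
  proof (rule maximal_matchingI[OF HYZ assms(3)])
    show "(\<Union>k. M k) \<subseteq> H" using M(2) unfolding L_def by blast
    fix y z assume yz: "(y, z) \<in> H"
    then have "l (y, z) > 0" using assms(7) by blast
    then obtain k where "(1 / 2) ^ k < l (y, z)" using real_arch_pow_inv[of "l (y, z)" "1 / 2"] by auto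
    then have "(y, z) \<in> L k" using yz unfolding L_def by simp
    from max[OF this] show "y \<in> Domain (\<Union>k. M k) \<or> z \<in> Range (\<Union>k. M k)" by blast
  qed (fact M(3,4))+
  moreover have "l (y, z) \<ge> 1 \<or> (1 / 2) * sup_unmatched Z H l (\<Union>k. M k) y \<le> ennreal (l (y, z))"
    if yz: "(y, z) \<in> (\<Union>k. M k)" for y z
  proof -
    obtain k where k: "(y, z) \<in> M k" using yz by blast
    then have lk: "(1 / 2) ^ k \<le> l (y, z)" using M(2) unfolding L_def by blast
    show ?thesis
    proof (cases k)
      \<comment> \<open>Edges of \<open>L 0\<close> have length at least 1, which is the first
        alternative.\<close>
      case 0
      then show ?thesis using lk by simp
    next
      case (Suc i)
      have "sup_unmatched Z H l (\<Union>k. M k) y \<le> ennreal (2 * l (y, z))"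
        unfolding sup_unmatched_def
      proof (rule SUP_least)
        fix z' assume z': "z' \<in> {z' \<in> space Z. (y, z') \<in> H} - space Z \<inter> matched_vertices (\<Union>k. M k)"
        have "(y, z') \<notin> L i"
        proof
          assume "(y, z') \<in> L i"
          \<comment> \<open>\<open>y\<close> is matched at stage \<open>Suc i\<close> and stages
            have disjoint domains, so \<open>y\<close> was free after stage \<open>i\<close>;
            maximality there forces \<open>z'\<close> to be matched.\<close>
          have "y \<notin> Domain (M j)" if "j \<le> i" for j
            using disj[of j k] that k Suc by auto
          with max[OF \<open>(y, z') \<in> L i\<close>] have "z' \<in> Range (\<Union>k. M k)" by blast
          then have "z' \<in> matched_vertices (\<Union>k. M k)"
            unfolding matched_vertices_def vertices_of_def by force
          then show False using z' by blast
        qed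
        then have "l (y, z') < (1 / 2) ^ i" using z' unfolding L_def by auto
        \<comment> \<open>The threshold of stage \<open>i\<close> is twice that of stage
          \<open>k\<close>, which is the source of the factor 2.\<close>
        then show "ennreal (l (y, z')) \<le> ennreal (2 * l (y, z))" using lk Suc by (intro ennreal_leI) simp
      qed
      then have "(1 / 2) * sup_unmatched Z H l (\<Union>k. M k) y \<le> (1 / 2) * ennreal (2 * l (y, z))"
        by (rule mult_left_mono) simp
      also have "\<dots> = ennreal (l (y, z))"
        by (simp add: ennreal_mult' mult.assoc[symmetric] ennreal_divide_times)
      finally show ?thesis by blast
    qed
  qed
  ultimately show ?thesis by blast
qed

end
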